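(* Let $M$ be an $n$-manifold. Suppose there is a $p$-dimensional compact submanifold $L$ of $M$ such that $M - L$ is embeddable into $\mathbb{R}^m$. Then for any smooth triangulation $K$ of $M$, the $(n-p-1)$-skeleton $K_{n-p-1}$ of $K$ is embeddable into $\mathbb{R}^m$.
   Context: All manifolds and submanifolds are smooth and without boundary. An embedding means a continuous map that is a homeomorphism onto its image (no smoothness required); a space is embeddable into $\mathbb{R}^m$ if such an embedding exists. A simplicial complex $K$ (identified with its geometric realization) is a smooth triangulation of a manifold $M$ if there is a homeomorphism $K \to M$ which restricts to a smooth embedding on each simplex of $K$. $K_j$ denotes the $j$-skeleton of $K$, i.e. the subcomplex of all simplices of dimension at most $j$ (empty if $j<0$). *)

theory Defs
  imports "HOL-Analysis.Analysis"
begin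

section \<open>Smooth functions on coordinate spaces\<close>

text \<open>\<open>coord_space I\<close> is the space of real vectors indexed by \<open>I\<close>, realised as the functions that
  vanish off \<open>I\<close>; for \<open>I = {..<n}\<close> it is the library's \<open>Euclidean_space n\<close>. The index set is a
  term rather than a type, so that dimensions (including 0) are ordinary natural numbers.\<close>

definition coord_space :: "'i set \<Rightarrow> ('i \<Rightarrow> real) topology" where
  "coord_space I = subtopology (powertop_real UNIV) {x. \<forall>i. i \<notin> I \<longrightarrow> x i = 0}"

lemma Euclidean_space_eq_coord_space: "Euclidean_space n = coord_space {..<n}"
  by (simp add: Euclidean_space_def coord_space_def not_less)

definition partial_deriv :: "'i \<Rightarrow> (('i \<Rightarrow> real) \<Rightarrow> real) \<Rightarrow> ('i \<Rightarrow> real) \<Rightarrow> real" where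
  "partial_deriv i f x = deriv (\<lambda>t. f (x(i := t))) (x i)"

text \<open>\<open>Ck_on I k U f\<close>: all iterated partial derivatives of \<open>f\<close> of order at most \<open>k\<close> exist and are
  continuous on \<open>U\<close>. Only used for finite \<open>I\<close> and \<open>U\<close> open in \<open>coord_space I\<close>.\<close>

primrec Ck_on ::
  "'i set \<Rightarrow> nat \<Rightarrow> ('i \<Rightarrow> real) set \<Rightarrow> (('i \<Rightarrow> real) \<Rightarrow> real) \<Rightarrow> bool" where
  "Ck_on I 0 U f \<longleftrightarrow> continuous_map (subtopology (coord_space I) U) euclideanreal f"
| "Ck_on I (Suc k) U f \<longleftrightarrow>
     continuous_map (subtopology (coord_space I) U) euclideanreal f \<and>
     (\<forall>i\<in>I. (\<forall>x\<in>U. (\<lambda>t. f (x(i := t))) field_differentiable (at (x i))) \<and>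
             Ck_on I k U (partial_deriv i f))"

definition smooth_on :: "'i set \<Rightarrow> ('i \<Rightarrow> real) set \<Rightarrow> (('i \<Rightarrow> real) \<Rightarrow> real) \<Rightarrow> bool" where
  "smooth_on I U f \<longleftrightarrow> openin (coord_space I) U \<and> (\<forall>k. Ck_on I k U f)"

definition smooth_map_on ::
  "'i set \<Rightarrow> nat \<Rightarrow> ('i \<Rightarrow> real) set \<Rightarrow> (('i \<Rightarrow> real) \<Rightarrow> nat \<Rightarrow> real) \<Rightarrow> bool" where
  "smooth_map_on I n U g \<longleftrightarrow>
     openin (coord_space I) U \<and> g ` U \<subseteq> topspace (Euclidean_space n) \<and>
     (\<forall>j<n. smooth_on I U (\<lambda>x. g x j))"


section \<open>Smooth manifolds and submanifolds\<close>

type_synonym 'a chart = "'a set \<times> ('a \<Rightarrow> nat \<Rightarrow> real)"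

definition is_chart :: "nat \<Rightarrow> 'a topology \<Rightarrow> 'a chart \<Rightarrow> bool" where
  "is_chart n M = (\<lambda>(U, \<phi>).
     openin M U \<and> openin (Euclidean_space n) (\<phi> ` U) \<and>
     homeomorphic_map (subtopology M U) (subtopology (Euclidean_space n) (\<phi> ` U)) \<phi>)"

definition compatible_charts :: "nat \<Rightarrow> 'a chart \<Rightarrow> 'a chart \<Rightarrow> bool" where
  "compatible_charts n = (\<lambda>(U, \<phi>) (V, \<psi>).
     smooth_map_on {..<n} n (\<phi> ` (U \<inter> V)) (\<lambda>y. \<psi> (inv_into U \<phi> y)) \<and>
     smooth_map_on {..<n} n (\<psi> ` (U \<inter> V)) (\<lambda>y. \<phi> (inv_into V \<psi> y)))"

definition second_countable_space :: "'a topology \<Rightarrow> bool" where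
  "second_countable_space M \<longleftrightarrow>
     (\<exists>\<B>. countable \<B> \<and> (\<forall>B\<in>\<B>. openin M B) \<and>
          (\<forall>U x. openin M U \<and> x \<in> U \<longrightarrow> (\<exists>B\<in>\<B>. x \<in> B \<and> B \<subseteq> U)))"

definition smooth_manifold :: "nat \<Rightarrow> 'a topology \<Rightarrow> 'a chart set \<Rightarrow> bool" where
  "smooth_manifold n M \<A> \<longleftrightarrow>
     Hausdorff_space M \<and> second_countable_space M \<and>
     (\<forall>c\<in>\<A>. is_chart n M c) \<and> (\<Union>c\<in>\<A>. fst c) = topspace M \<and>
     (\<forall>c\<in>\<A>. \<forall>d\<in>\<A>. compatible_charts n c d)"

text \<open>The atlas \<open>\<A>\<close> need not be maximal; \<open>smooth_charts\<close> is the maximal atlas it generates.\<close>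

definition smooth_charts :: "nat \<Rightarrow> 'a topology \<Rightarrow> 'a chart set \<Rightarrow> 'a chart set" where
  "smooth_charts n M \<A> = {c. is_chart n M c \<and> (\<forall>d\<in>\<A>. compatible_charts n c d)}"

text \<open>Embedded submanifolds, through slice charts. Note that \<open>topspace (Euclidean_space p)\<close> is the
  set of vectors whose coordinates from index \<open>p\<close> on vanish, that is, for \<open>p \<le> n\<close> the standard
  \<open>p\<close>-dimensional coordinate subspace of \<open>Euclidean_space n\<close>.\<close>

definition smooth_submanifold ::
  "nat \<Rightarrow> 'a topology \<Rightarrow> 'a chart set \<Rightarrow> nat \<Rightarrow> 'a set \<Rightarrow> bool" where
  "smooth_submanifold n M \<A> p L \<longleftrightarrow>
     L \<subseteq> topspace M \<and>
     (\<forall>x\<in>L. p \<le> n \<and>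
        (\<exists>(U, \<phi>)\<in>smooth_charts n M \<A>.
            x \<in> U \<and> \<phi> ` (U \<inter> L) = \<phi> ` U \<inter> topspace (Euclidean_space p)))"


section \<open>Simplicial complexes and smooth triangulations\<close>

text \<open>A complex is given by the vertex sets of its simplices. It may be infinite.\<close>

definition simplicial_cx :: "'v set set \<Rightarrow> bool" where
  "simplicial_cx K \<longleftrightarrow>
     (\<forall>\<sigma>\<in>K. finite \<sigma> \<and> \<sigma> \<noteq> {}) \<and> (\<forall>\<sigma>\<in>K. \<forall>\<tau>. \<tau> \<subseteq> \<sigma> \<and> \<tau> \<noteq> {} \<longrightarrow> \<tau> \<in> K)"

text \<open>The dimension is an integer, so that skeleta of negative dimension are empty.\<close>

definition skeleton :: "int \<Rightarrow> 'v set set \<Rightarrow> 'v set set" where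
  "skeleton j K = {\<sigma>\<in>K. int (card \<sigma>) - 1 \<le> j}"

text \<open>The closed simplex spanned by \<open>\<sigma>\<close>, in barycentric coordinates.\<close>

definition geom_simplex :: "'v set \<Rightarrow> ('v \<Rightarrow> real) set" where
  "geom_simplex \<sigma> =
     {t. (\<forall>v. 0 \<le> t v) \<and> (\<forall>v. v \<notin> \<sigma> \<longrightarrow> t v = 0) \<and> (\<Sum>v\<in>\<sigma>. t v) = 1}"

definition simplex_top :: "'v set \<Rightarrow> ('v \<Rightarrow> real) topology" where
  "simplex_top \<sigma> = subtopology (coord_space \<sigma>) (geom_simplex \<sigma>)"

text \<open>The geometric realization carries the weak (coherent) topology determined by the simplices.\<close>

definition realization :: "'v set set \<Rightarrow> ('v \<Rightarrow> real) topology" where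
  "realization K = topology (\<lambda>U. U \<subseteq> (\<Union>\<sigma>\<in>K. geom_simplex \<sigma>) \<and>
     (\<forall>\<sigma>\<in>K. openin (simplex_top \<sigma>) (U \<inter> geom_simplex \<sigma>)))"

lemma topspace_simplex_top: "topspace (simplex_top \<sigma>) = geom_simplex \<sigma>"
  by (auto simp: simplex_top_def coord_space_def geom_simplex_def)

lemma openin_realization:
  "openin (realization K) U \<longleftrightarrow> U \<subseteq> (\<Union>\<sigma>\<in>K. geom_simplex \<sigma>) \<and>
     (\<forall>\<sigma>\<in>K. openin (simplex_top \<sigma>) (U \<inter> geom_simplex \<sigma>))"
proof -
  let ?P = "\<lambda>U. U \<subseteq> (\<Union>\<sigma>\<in>K. geom_simplex \<sigma>) \<and>
     (\<forall>\<sigma>\<in>K. openin (simplex_top \<sigma>) (U \<inter> geom_simplex \<sigma>))"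
  have "istopology ?P"
    unfolding istopology_def
  proof (intro conjI allI impI)
    fix S T assume *: "?P S" "?P T"
    show "S \<inter> T \<subseteq> (\<Union>\<sigma>\<in>K. geom_simplex \<sigma>)" using * by blast
    show "\<forall>\<sigma>\<in>K. openin (simplex_top \<sigma>) (S \<inter> T \<inter> geom_simplex \<sigma>)"
    proof
      fix \<sigma> assume "\<sigma> \<in> K"
      then have "openin (simplex_top \<sigma>) ((S \<inter> geom_simplex \<sigma>) \<inter> (T \<inter> geom_simplex \<sigma>))"
        using * by blast
      moreover have "(S \<inter> geom_simplex \<sigma>) \<inter> (T \<inter> geom_simplex \<sigma>) = S \<inter> T \<inter> geom_simplex \<sigma>"
        by blast
      ultimately show "openin (simplex_top \<sigma>) (S \<inter> T \<inter> geom_simplex \<sigma>)"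
        by (rule back_subst)
    qed
  next
    fix \<U> assume *: "\<forall>U\<in>\<U>. ?P U"
    then show "\<Union>\<U> \<subseteq> (\<Union>\<sigma>\<in>K. geom_simplex \<sigma>)" by blast
    show "\<forall>\<sigma>\<in>K. openin (simplex_top \<sigma>) (\<Union>\<U> \<inter> geom_simplex \<sigma>)"
      unfolding Int_Union2 using * by blast
  qed
  then show ?thesis
    by (simp add: realization_def topology_inverse')
qed

lemma topspace_realization: "topspace (realization K) = (\<Union>\<sigma>\<in>K. geom_simplex \<sigma>)"
proof -
  have "openin (simplex_top \<sigma>) ((\<Union>\<tau>\<in>K. geom_simplex \<tau>) \<inter> geom_simplex \<sigma>)" if "\<sigma> \<in> K" for \<sigma>
  proof -
    have "(\<Union>\<tau>\<in>K. geom_simplex \<tau>) \<inter> geom_simplex \<sigma> = topspace (simplex_top \<sigma>)"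
      using that by (auto simp: topspace_simplex_top)
    then show ?thesis by simp
  qed
  then have "openin (realization K) (\<Union>\<sigma>\<in>K. geom_simplex \<sigma>)"
    by (simp add: openin_realization)
  then show ?thesis
    by (meson openin_realization openin_subset openin_topspace subset_antisym)
qed

text \<open>A smooth embedding of a closed simplex: a topological embedding which, in charts, extends
  locally to a smooth map \<open>g\<close> on an open set of the ambient \<open>coord_space \<sigma>\<close> and whose differential
  is injective at every point of the simplex, including boundary points. The tangent space of the
  simplex consists of the vectors \<open>w\<close> with coordinate sum 0; on it the differential of \<open>g\<close> does not
  depend on the extension.\<close>

definition smooth_simplex_embedding ::
  "nat \<Rightarrow> 'a topology \<Rightarrow> 'a chart set \<Rightarrow> 'v set \<Rightarrow> (('v \<Rightarrow> real) \<Rightarrow> 'a) \<Rightarrow> bool" where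
  "smooth_simplex_embedding n M \<A> \<sigma> h \<longleftrightarrow>
     embedding_map (simplex_top \<sigma>) M h \<and>
     (\<forall>x\<in>geom_simplex \<sigma>. \<exists>(U, \<phi>)\<in>smooth_charts n M \<A>. \<exists>W g.
        x \<in> W \<and> smooth_map_on \<sigma> n W g \<and>
        (\<forall>y\<in>W \<inter> geom_simplex \<sigma>. h y \<in> U \<and> \<phi> (h y) = g y) \<and>
        (\<forall>w. (\<Sum>v\<in>\<sigma>. w v) = 0 \<and>
             (\<forall>j<n. (\<Sum>v\<in>\<sigma>. w v * partial_deriv v (\<lambda>y. g y j) x) = 0) \<longrightarrow>
             (\<forall>v\<in>\<sigma>. w v = 0)))"

definition smooth_triangulation ::
  "nat \<Rightarrow> 'a topology \<Rightarrow> 'a chart set \<Rightarrow> 'v set set \<Rightarrow> bool" where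
  "smooth_triangulation n M \<A> K \<longleftrightarrow>
     simplicial_cx K \<and>
     (\<exists>h. homeomorphic_map (realization K) M h \<and>
          (\<forall>\<sigma>\<in>K. smooth_simplex_embedding n M \<A> \<sigma> h))"


definition embeddable_in_R :: "'a topology \<Rightarrow> nat \<Rightarrow> bool" where
  "embeddable_in_R X m \<longleftrightarrow> (\<exists>f. embedding_map X (Euclidean_space m) f)"

end

theory Submission
  imports Defs
begin

text \<open>The skeleton has dimension \<open>n - p - 1\<close>, so a small perturbation of the triangulating map \<open>h\<close>
  moves its image off \<open>L\<close>. Cover \<open>L\<close> by finitely many balls in slice charts and treat them one at a
  time: in a slice chart \<open>L\<close> is the zero set of the last \<open>n - p\<close> coordinates, so it suffices to translate,
  with a Lipschitz cutoff, by a small vector in these coordinates that avoids the projection of the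
  image of the skeleton. Such a vector exists because this projection is a finite union of
  Lipschitz images of simplices of dimension less than \<open>n - p\<close>. A small translation keeps the image
  off the parts of \<open>L\<close> already treated. The cut-off translations need only be continuous, closed and
  injective on \<open>M\<close>, not surjective; for the induction, local Lipschitz continuity on the simplices
  replaces smoothness.\<close>

section \<open>The sum metric on coordinate spaces\<close>

text \<open>Where the cutoff is 1, a moved point lies on the slice only if its last
  \<open>n - p\<close> coordinates before the move cancel the translation, so it is enough to omit a
  single value of a map from a complex of dimension less than \<open>n - p\<close>. Covering numbers
  do the work of Sard's theorem or of measure: they ask for Lipschitz bounds only, and these survive
  a piecewise linear cutoff.

  The obstacle is that the complex may be infinite, so neither Lipschitz constants nor distances to
  the treated parts can be bounded globally. Closedness supplies the finiteness. A closed injective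
  map is proper, so the preimage of a compact chart ball is compact and lies in finitely many closed
  simplices. The image is a closed set, so inside such a ball it keeps a positive distance from the
  treated parts, and this distance limits the next translation. Closedness itself persists because
  each move is the identity off a compact set. At the end, continuity, closedness and injectivity
  give an embedding into \<open>M - L\<close>, to be followed by the given embedding into Euclidean
  space.\<close>

definition l1 :: "'i set \<Rightarrow> ('i \<Rightarrow> real) \<Rightarrow> ('i \<Rightarrow> real) \<Rightarrow> real" where
  "l1 I x y = (\<Sum>i\<in>I. \<bar>x i - y i\<bar>)"

lemma l1_nonneg [simp]: "0 \<le> l1 I x y"
  by (simp add: l1_def sum_nonneg)

lemma l1_self [simp]: "l1 I x x = 0"
  by (simp add: l1_def)

lemma l1_commute: "l1 I x y = l1 I y x"
  by (simp add: l1_def abs_minus_commute)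

lemma l1_triangle: "l1 I x z \<le> l1 I x y + l1 I y z"
  unfolding l1_def sum.distrib[symmetric] by (rule sum_mono) linarith

lemma l1_coord_le: "finite I \<Longrightarrow> i \<in> I \<Longrightarrow> \<bar>x i - y i\<bar> \<le> l1 I x y"
  unfolding l1_def by (rule member_le_sum) auto

lemma l1_mono: "finite I \<Longrightarrow> J \<subseteq> I \<Longrightarrow> l1 J x y \<le> l1 I x y"
  unfolding l1_def by (rule sum_mono2) auto

lemma continuous_on_l1 [continuous_intros]:
  fixes f g :: "'b::topological_space \<Rightarrow> 'i \<Rightarrow> real"
  assumes "continuous_on S f" "continuous_on S g"
  shows "continuous_on S (\<lambda>x. l1 I (f x) (g x))"
proof -
  have "continuous_on S (\<lambda>x. h x i)" if "continuous_on S h" for h :: "'b \<Rightarrow> 'i \<Rightarrow> real" and i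
    using that by (rule continuous_on_product_then_coordinatewise)
  then show ?thesis
    unfolding l1_def using assms by (intro continuous_intros) auto
qed

lemma open_l1_ball: "open {y. l1 I x y < e}"
  by (intro open_Collect_less continuous_intros)

lemma closed_l1_ball: "closed {y. l1 I x y \<le> e}"
  by (intro closed_Collect_le continuous_intros)

lemma coord_space_eq: "coord_space I = top_of_set {x. \<forall>i. i \<notin> I \<longrightarrow> x i = 0}"
  by (simp add: coord_space_def euclidean_product_topology)

lemma topspace_coord_space: "topspace (coord_space I) = {x. \<forall>i. i \<notin> I \<longrightarrow> x i = 0}"
  by (simp add: coord_space_eq)

text \<open>On all functions \<open>l1 I\<close> is only a pseudometric; it separates the points of
  \<open>coord_space I\<close> because these agree off \<open>I\<close>.\<close>

lemma l1_eq_0_imp_eq: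
  assumes "finite I" "x \<in> topspace (coord_space I)" "y \<in> topspace (coord_space I)" "l1 I x y = 0"
  shows "x = y"
proof
  fix i
  show "x i = y i"
  proof (cases "i \<in> I")
    case True
    then show ?thesis using l1_coord_le[OF assms(1) True, of x y] assms(4) by simp
  next
    case False
    then show ?thesis using assms by (simp add: topspace_coord_space)
  qed
qed

text \<open>Points of \<open>coord_space I\<close> agree off \<open>I\<close>, so a basic open box
  constrains only the finitely many coordinates in \<open>I\<close>, and the least of their margins
  serves as radius. The extra element 1 in the minimum covers empty \<open>I\<close>.\<close>

lemma openin_coord_space_ball:
  assumes "openin (coord_space I) U" "finite I" "x \<in> U"
  obtains e where "e > 0" "\<And>y. y \<in> topspace (coord_space I) \<Longrightarrow> l1 I x y < e \<Longrightarrow> y \<in> U"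
proof -
  obtain T where T: "openin (powertop_real UNIV) T" "U = T \<inter> {x. \<forall>i. i \<notin> I \<longrightarrow> x i = 0}"
    using assms(1) by (auto simp: coord_space_def openin_subtopology)
  then obtain V where V: "\<And>i. open (V i)" "x \<in> PiE UNIV V" "PiE UNIV V \<subseteq> T"
    using assms(3) by (fastforce simp: openin_product_topology_alt)
  have "\<exists>e>0. \<forall>t. \<bar>t - x i\<bar> < e \<longrightarrow> t \<in> V i" for i
    using V(1)[of i] V(2) by (auto simp: open_dist dist_real_def)
  then obtain e where e: "\<And>i. e i > 0" "\<And>i t. \<bar>t - x i\<bar> < e i \<Longrightarrow> t \<in> V i" by metis
  define d where "d = Min (insert 1 (e ` I))"
  have d: "d > 0" "\<And>i. i \<in> I \<Longrightarrow> d \<le> e i"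
    using assms(2) e(1) by (auto simp: d_def)
  show thesis
  proof (rule that[OF d(1)])
    fix y assume y: "y \<in> topspace (coord_space I)" "l1 I x y < d"
    have "y i \<in> V i" for i
    proof (cases "i \<in> I")
      case True
      then show ?thesis
        using l1_coord_le[OF assms(2) True, of x y] d(2)[OF True] y(2) by (intro e(2)) linarith
    next
      case False
      then have "y i = x i" using y(1) T(2) assms(3) by (simp add: topspace_coord_space)
      then show ?thesis using V(2) by auto
    qed
    then show "y \<in> U" using T(2) V(3) y(1) by (auto simp: topspace_coord_space)
  qed
qed

lemma compact_l1_cball:
  assumes "finite I"
  shows "compact {x \<in> topspace (coord_space I). l1 I a x \<le> R}"
proof -
  \<comment> \<open>Tychonoff: the ball is a closed subset of a product of compact factors, which
    are singletons off \<open>I\<close>.\<close>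
  define B where "B = PiE UNIV (\<lambda>i. if i \<in> I then {a i - R..a i + R} else {0::real})"
  have "compactin (powertop_real UNIV) B"
    by (simp add: B_def compactin_PiE)
  then have "compact B" by (simp add: euclidean_product_topology)
  moreover have "closed {x. l1 I a x \<le> R}" by (rule closed_l1_ball)
  moreover have "closed {x. \<forall>i. i \<notin> I \<longrightarrow> x i = (0::real)}"
    by (intro closed_Collect_all closed_Collect_imp closed_Collect_eq continuous_intros) auto
  ultimately have "compact (B \<inter> ({x. l1 I a x \<le> R} \<inter> {x. \<forall>i. i \<notin> I \<longrightarrow> x i = (0::real)}))"
    by blast
  moreover have "x \<in> B" if "x \<in> topspace (coord_space I)" "l1 I a x \<le> R" for x
  proof -
    have "\<bar>a i - x i\<bar> \<le> R" if "i \<in> I" for i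
      using l1_coord_le[OF assms that, of a x] \<open>l1 I a x \<le> R\<close> by linarith
    then show ?thesis using that(1) by (fastforce simp: B_def topspace_coord_space abs_le_iff)
  qed
  then have "B \<inter> ({x. l1 I a x \<le> R} \<inter> {x. \<forall>i. i \<notin> I \<longrightarrow> x i = (0::real)}) =
      {x \<in> topspace (coord_space I). l1 I a x \<le> R}"
    by (auto simp: topspace_coord_space)
  ultimately show ?thesis by simp
qed

lemma compact_disjoint_l1_separated:
  assumes "finite I" "compact A" "compact B" "A \<inter> B = {}"
    "A \<subseteq> topspace (coord_space I)" "B \<subseteq> topspace (coord_space I)"
  obtains e where "e > 0" "\<And>x y. x \<in> A \<Longrightarrow> y \<in> B \<Longrightarrow> e \<le> l1 I x y"
proof (cases "A \<times> B = {}")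
  case True
  then show ?thesis using that[of 1] by auto
next
  case False
  have "continuous_on (A \<times> B) (\<lambda>z. l1 I (fst z) (snd z))"
    by (intro continuous_intros)
  then obtain z where z: "z \<in> A \<times> B" "\<And>u. u \<in> A \<times> B \<Longrightarrow> l1 I (fst z) (snd z) \<le> l1 I (fst u) (snd u)"
    using continuous_attains_inf[OF compact_Times[OF assms(2,3)] False] by blast
  have "fst z \<noteq> snd z" using z(1) assms(4) by auto
  moreover have "fst z \<in> topspace (coord_space I)" "snd z \<in> topspace (coord_space I)"
    using z(1) assms(5,6) by auto
  ultimately have "l1 I (fst z) (snd z) > 0"
    using l1_eq_0_imp_eq[OF assms(1)] l1_nonneg[of I "fst z" "snd z"] by (metis less_eq_real_def)
  then show ?thesis using that z(2) by force
qed

section \<open>Smooth maps are locally Lipschitz\<close>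

text \<open>The coordinates of \<open>y\<close> are replaced by those of \<open>z\<close> one at a
  time, with the mean value inequality at each replacement; as \<open>l1\<close> is a sum over
  coordinates, the bounds add up exactly. Each coordinate of an intermediate point lies between
  those of \<open>y\<close> and \<open>z\<close>, so its distance from \<open>x\<close> is at most
  the sum of both distances. Hence the hypothesis bounds the sum.\<close>

lemma l1_lipschitz_of_partial_bound:
  assumes "finite I"
    and diff: "\<And>k u. k \<in> I \<Longrightarrow> u \<in> topspace (coord_space I) \<Longrightarrow> l1 I x u < e \<Longrightarrow>
         (\<lambda>t. f (u(k := t))) field_differentiable (at (u k)) \<and> \<bar>partial_deriv k f u\<bar> \<le> B"
    and y: "y \<in> topspace (coord_space I)" and z: "z \<in> topspace (coord_space I)"
    and yz: "l1 I x y + l1 I x z < e"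
  shows "\<bar>f y - f z\<bar> \<le> B * l1 I y z"
proof -
  define mix where "mix J = (\<lambda>i. if i \<in> J then z i else y i)" for J
  have "\<bar>f y - f (mix J)\<bar> \<le> B * l1 J y z" if "J \<subseteq> I" for J
    using finite_subset[OF that assms(1)] that
  proof (induction J rule: finite_induct)
    case empty
    then show ?case by (simp add: mix_def l1_def)
  next
    case (insert k J)
    have kI: "k \<in> I" using insert by auto
    define g where "g t = f ((mix J)(k := t))" for t
    have ins: "mix (insert k J) = (mix J)(k := z k)" "mix J = (mix J)(k := y k)"
      using insert by (auto simp: mix_def)
    have der: "(g has_field_derivative partial_deriv k f ((mix J)(k := t))) (at t) \<and>
        \<bar>partial_deriv k f ((mix J)(k := t))\<bar> \<le> B" if "t \<in> closed_segment (y k) (z k)" for t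
    proof -
      let ?u = "(mix J)(k := t)"
      have "?u \<in> topspace (coord_space I)"
        using y z kI by (auto simp: mix_def topspace_coord_space)
      moreover have "l1 I x ?u \<le> l1 I x y + l1 I x z"
        unfolding l1_def sum.distrib[symmetric]
      proof (rule sum_mono)
        fix i assume "i \<in> I"
        show "\<bar>x i - ?u i\<bar> \<le> \<bar>x i - y i\<bar> + \<bar>x i - z i\<bar>"
          using that by (auto simp: mix_def closed_segment_eq_real_ivl split: if_splits)
      qed
      ultimately have *: "(\<lambda>s. f (?u(k := s))) field_differentiable (at (?u k))"
          "\<bar>partial_deriv k f ?u\<bar> \<le> B"
        using diff[OF kI] yz by fastforce+
      then have "g field_differentiable (at t)" by (simp add: g_def[abs_def])
      moreover have "partial_deriv k f ?u = deriv g t"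
        by (simp add: partial_deriv_def g_def[abs_def])
      ultimately show ?thesis
        using *(2) by (simp add: DERIV_deriv_iff_field_differentiable)
    qed
    have "norm (g (y k) - g (z k)) \<le> B * norm (y k - z k)"
    proof (rule field_differentiable_bound[of "closed_segment (y k) (z k)"])
      show "(g has_field_derivative partial_deriv k f ((mix J)(k := t)))
          (at t within closed_segment (y k) (z k))" if "t \<in> closed_segment (y k) (z k)" for t
        using der[OF that] has_field_derivative_at_within by blast
    qed (use der in auto)
    then have "\<bar>f (mix J) - f (mix (insert k J))\<bar> \<le> B * \<bar>y k - z k\<bar>"
      using ins by (simp add: g_def)
    moreover have "l1 (insert k J) y z = \<bar>y k - z k\<bar> + l1 J y z"
      using insert by (simp add: l1_def)
    moreover have "\<bar>f y - f (mix J)\<bar> \<le> B * l1 J y z" using insert by simp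
    ultimately show ?case by (simp add: distrib_left)
  qed
  moreover have "mix I = z"
    using y z by (auto simp: mix_def topspace_coord_space)
  ultimately show ?thesis by fastforce
qed

lemma smooth_on_locally_lipschitz:
  assumes "finite I" "smooth_on I U f" "x \<in> U"
  obtains e C where "e > 0" "C \<ge> 0"
    "\<And>y z. \<lbrakk>y \<in> topspace (coord_space I); z \<in> topspace (coord_space I); l1 I x y < e; l1 I x z < e\<rbrakk>
        \<Longrightarrow> \<bar>f y - f z\<bar> \<le> C * l1 I y z"
proof -
  have U: "openin (coord_space I) U" and C1: "Ck_on I (Suc 0) U f"
    using assms(2) unfolding smooth_on_def by blast+
  obtain e0 where e0: "e0 > 0" "\<And>y. y \<in> topspace (coord_space I) \<Longrightarrow> l1 I x y < e0 \<Longrightarrow> y \<in> U"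
    using openin_coord_space_ball[OF U assms(1,3)] by blast
  let ?B = "\<lambda>i. \<bar>partial_deriv i f x\<bar> + 1"
  have "\<exists>e>0. \<forall>y\<in>topspace (coord_space I). l1 I x y < e \<longrightarrow> \<bar>partial_deriv i f y\<bar> < ?B i"
    if i: "i \<in> I" for i
  proof -
    define V where "V = {y \<in> topspace (subtopology (coord_space I) U).
        partial_deriv i f y \<in> {-?B i<..<?B i}}"
    have "continuous_map (subtopology (coord_space I) U) euclideanreal (partial_deriv i f)"
      using C1 i by simp
    then have "openin (subtopology (coord_space I) U) V"
      unfolding V_def by (rule openin_continuous_map_preimage) simp
    then have V: "openin (coord_space I) V"
      using U by (rule openin_trans_full)
    have "x \<in> V"
      using assms(3) openin_subset[OF U] by (auto simp: V_def abs_if)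
    then obtain e where e: "e > 0" "\<And>y. y \<in> topspace (coord_space I) \<Longrightarrow> l1 I x y < e \<Longrightarrow> y \<in> V"
      using openin_coord_space_ball[OF V assms(1)] by blast
    have "\<bar>partial_deriv i f y\<bar> < ?B i" if "y \<in> topspace (coord_space I)" "l1 I x y < e" for y
      using e(2)[OF that] by (auto simp: V_def)
    with e(1) show ?thesis by blast
  qed
  then obtain e1 where e1: "\<And>i. i \<in> I \<Longrightarrow> e1 i > 0"
    "\<And>i y. i \<in> I \<Longrightarrow> y \<in> topspace (coord_space I) \<Longrightarrow> l1 I x y < e1 i \<Longrightarrow> \<bar>partial_deriv i f y\<bar> < ?B i"
    by metis
  define e where "e = Min (insert e0 (e1 ` I))"
  have e: "e > 0" "e \<le> e0" "\<And>i. i \<in> I \<Longrightarrow> e \<le> e1 i"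
    using assms(1) e0(1) e1(1) by (auto simp: e_def)
  define B where "B = (\<Sum>i\<in>I. ?B i)"
  have B: "?B i \<le> B" if "i \<in> I" for i
    unfolding B_def by (rule member_le_sum[OF that _ assms(1)]) auto
  have B0: "B \<ge> 0" unfolding B_def by (intro sum_nonneg) auto
  show thesis
  \<comment> \<open>Half the radius, because the two distances from \<open>x\<close> must add up to
    less than \<open>e\<close>.\<close>
  proof (rule that[of "e/2" B])
    fix y z assume *: "y \<in> topspace (coord_space I)" "z \<in> topspace (coord_space I)"
      "l1 I x y < e / 2" "l1 I x z < e / 2"
    show "\<bar>f y - f z\<bar> \<le> B * l1 I y z"
    proof (rule l1_lipschitz_of_partial_bound[OF assms(1) _ *(1,2), of x e])
      fix k u assume u: "k \<in> I" "u \<in> topspace (coord_space I)" "l1 I x u < e"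
      then have "u \<in> U" using e0(2)[of u] e(2) by linarith
      moreover have "\<bar>partial_deriv k f u\<bar> < ?B k"
        using e1(2)[OF u(1,2)] u(3) e(3)[OF u(1)] by linarith
      ultimately show "(\<lambda>t. f (u(k := t))) field_differentiable at (u k) \<and> \<bar>partial_deriv k f u\<bar> \<le> B"
        using C1 u(1) B[OF u(1)] by simp
    qed (use *(3,4) in linarith)
  qed (use e B0 in auto)
qed

lemma smooth_map_on_locally_lipschitz:
  assumes "finite I" "smooth_map_on I n U g" "x \<in> U"
  obtains e C where "e > 0" "C \<ge> 0"
    "\<And>y. y \<in> topspace (coord_space I) \<Longrightarrow> l1 I x y < e \<Longrightarrow> y \<in> U"
    "\<And>y z. \<lbrakk>y \<in> topspace (coord_space I); z \<in> topspace (coord_space I); l1 I x y < e; l1 I x z < e\<rbrakk>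
        \<Longrightarrow> l1 {..<n} (g y) (g z) \<le> C * l1 I y z"
proof -
  have "\<exists>e C. e > 0 \<and> C \<ge> 0 \<and> (\<forall>y\<in>topspace (coord_space I). \<forall>z\<in>topspace (coord_space I).
      l1 I x y < e \<longrightarrow> l1 I x z < e \<longrightarrow> \<bar>g y j - g z j\<bar> \<le> C * l1 I y z)" if "j < n" for j
  proof -
    have "smooth_on I U (\<lambda>x. g x j)" using assms(2) that by (simp add: smooth_map_on_def)
    from smooth_on_locally_lipschitz[OF assms(1) this assms(3)] obtain e C
      where "e > 0" "C \<ge> 0" "\<And>y z. \<lbrakk>y \<in> topspace (coord_space I); z \<in> topspace (coord_space I);
        l1 I x y < e; l1 I x z < e\<rbrakk> \<Longrightarrow> \<bar>g y j - g z j\<bar> \<le> C * l1 I y z" by blast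
    then show ?thesis by blast
  qed
  then have "\<exists>e C. \<forall>j<n. e j > 0 \<and> C j \<ge> 0 \<and> (\<forall>y\<in>topspace (coord_space I). \<forall>z\<in>topspace (coord_space I).
      l1 I x y < e j \<longrightarrow> l1 I x z < e j \<longrightarrow> \<bar>g y j - g z j\<bar> \<le> C j * l1 I y z)"
    by metis
  then obtain e C where eC: "\<And>j. j < n \<Longrightarrow> e j > 0" "\<And>j. j < n \<Longrightarrow> C j \<ge> (0::real)"
    "\<And>j y z. \<lbrakk>j < n; y \<in> topspace (coord_space I); z \<in> topspace (coord_space I);
      l1 I x y < e j; l1 I x z < e j\<rbrakk> \<Longrightarrow> \<bar>g y j - g z j\<bar> \<le> C j * l1 I y z"
    by blast
  obtain e0 where e0: "e0 > 0" "\<And>y. y \<in> topspace (coord_space I) \<Longrightarrow> l1 I x y < e0 \<Longrightarrow> y \<in> U"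
    using openin_coord_space_ball[OF _ assms(1,3)] assms(2) smooth_map_on_def by blast
  define d where "d = Min (insert e0 (e ` {..<n}))"
  have d: "d > 0" "d \<le> e0" "\<And>j. j < n \<Longrightarrow> d \<le> e j"
    using e0(1) eC(1) by (auto simp: d_def)
  show thesis
  proof (rule that[of d "sum C {..<n}"])
    show "l1 {..<n} (g y) (g z) \<le> sum C {..<n} * l1 I y z"
      if *: "y \<in> topspace (coord_space I)" "z \<in> topspace (coord_space I)"
        "l1 I x y < d" "l1 I x z < d" for y z
      unfolding l1_def[of "{..<n}"] sum_distrib_right
    proof (rule sum_mono)
      fix j assume "j \<in> {..<n}"
      then have "j < n" "d \<le> e j" using d(3) by auto
      then show "\<bar>g y j - g z j\<bar> \<le> C j * l1 I y z"
        using eC(3)[OF \<open>j < n\<close> *(1,2)] *(3,4) by linarith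
    qed
    show "d > 0" by (rule d(1))
    show "sum C {..<n} \<ge> 0" using eC(2) by (intro sum_nonneg) auto
    show "y \<in> U" if "y \<in> topspace (coord_space I)" "l1 I x y < d" for y
      using e0(2)[OF that(1)] that(2) d(2) by linarith
  qed
qed

section \<open>Lipschitz images of low-dimensional simplices\<close>

text \<open>The inequality is strict so that no member can contain points over two different nodes
  of the grid of mesh \<open>1 / N\<close> in the \<open>J\<close>-coordinates.\<close>

definition fine_cover :: "'i set \<Rightarrow> nat \<Rightarrow> ('i \<Rightarrow> real) set set \<Rightarrow> ('i \<Rightarrow> real) set \<Rightarrow> bool" where
  "fine_cover J N P S \<longleftrightarrow> finite P \<and> S \<subseteq> \<Union>P \<and> (\<forall>B\<in>P. \<forall>x\<in>B. \<forall>y\<in>B. real N * l1 J x y < 1)"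

text \<open>Covering numbers at scale \<open>1 / N\<close> grow one power of \<open>N\<close> slower than those of a cube in
  \<open>coord_space J\<close>.\<close>

definition small :: "'i set \<Rightarrow> ('i \<Rightarrow> real) set \<Rightarrow> bool" where
  "small J S \<longleftrightarrow> (\<exists>c::nat. \<forall>N\<ge>1. \<exists>P. fine_cover J N P S \<and> card P \<le> c * N ^ (card J - 1))"

lemma small_empty: "small J {}"
proof -
  have "fine_cover J N {} {}" for N by (simp add: fine_cover_def)
  then show ?thesis unfolding small_def by (metis card.empty le0)
qed

lemma small_subset:
  assumes "small J T" "S \<subseteq> T"
  shows "small J S"
proof -
  have "fine_cover J N P S" if "fine_cover J N P T" for N P
    using that assms(2) unfolding fine_cover_def by (meson subset_trans)
  then show ?thesis using assms(1) unfolding small_def by meson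
qed

lemma small_Un:
  assumes "small J S" "small J T"
  shows "small J (S \<union> T)"
proof -
  obtain c d where
    c: "\<And>N. N \<ge> 1 \<Longrightarrow> \<exists>P. fine_cover J N P S \<and> card P \<le> c * N ^ (card J - 1)" and
    d: "\<And>N. N \<ge> 1 \<Longrightarrow> \<exists>P. fine_cover J N P T \<and> card P \<le> d * N ^ (card J - 1)"
    using assms unfolding small_def by meson
  have "\<exists>P. fine_cover J N P (S \<union> T) \<and> card P \<le> (c + d) * N ^ (card J - 1)" if N: "N \<ge> 1" for N
  proof -
    obtain P where P: "fine_cover J N P S" "card P \<le> c * N ^ (card J - 1)"
      using c[OF N] by blast
    obtain Q where Q: "fine_cover J N Q T" "card Q \<le> d * N ^ (card J - 1)"
      using d[OF N] by blast
    have "fine_cover J N (P \<union> Q) (S \<union> T)"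
      using P(1) Q(1) unfolding fine_cover_def by (simp add: ball_Un le_supI1 le_supI2)
    moreover have "card (P \<union> Q) \<le> (c + d) * N ^ (card J - 1)"
      using card_Un_le[of P Q] P(2) Q(2) by (simp add: distrib_right)
    ultimately show ?thesis by blast
  qed
  then show ?thesis unfolding small_def by blast
qed

lemma small_UN: "finite F \<Longrightarrow> (\<And>k. k \<in> F \<Longrightarrow> small J (S k)) \<Longrightarrow> small J (\<Union>k\<in>F. S k)"
  by (induction F rule: finite_induct) (simp_all add: small_empty small_Un)

text \<open>Any coordinate \<open>v\<close> of a simplex is determined by the others, so one dimension is saved.\<close>

lemma l1_simplex_le:
  assumes "finite \<sigma>" "v \<in> \<sigma>" "y \<in> geom_simplex \<sigma>" "z \<in> geom_simplex \<sigma>"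
  shows "l1 \<sigma> y z \<le> 2 * l1 (\<sigma> - {v}) y z"
proof -
  have "y v = 1 - (\<Sum>i\<in>\<sigma> - {v}. y i)" "z v = 1 - (\<Sum>i\<in>\<sigma> - {v}. z i)"
    using assms(3,4) sum.remove[OF assms(1,2), of y] sum.remove[OF assms(1,2), of z]
    by (simp_all add: geom_simplex_def)
  then have "\<bar>y v - z v\<bar> = \<bar>\<Sum>i\<in>\<sigma> - {v}. (z i - y i)\<bar>"
    by (simp add: sum_subtractf)
  also have "\<dots> \<le> l1 (\<sigma> - {v}) y z"
    unfolding l1_def by (rule order_trans[OF sum_abs]) (simp add: abs_minus_commute)
  finally have "\<bar>y v - z v\<bar> \<le> l1 (\<sigma> - {v}) y z" .
  moreover have "l1 \<sigma> y z = \<bar>y v - z v\<bar> + l1 (\<sigma> - {v}) y z"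
    unfolding l1_def by (rule sum.remove[OF assms(1,2)])
  ultimately show ?thesis by linarith
qed

text \<open>The \<open>card \<sigma> - 1\<close> free barycentric coordinates are cut into cells of
  side \<open>1 / (N * m)\<close>, with \<open>m\<close> independent of \<open>N\<close>; the images
  of the cells form the cover. Their number is of order \<open>N ^ (card \<sigma> - 1)\<close>,
  which the hypothesis on cardinalities turns into the exponent wanted.\<close>

lemma small_lipschitz_image:
  assumes "finite \<sigma>" "\<sigma> \<noteq> {}" "card \<sigma> \<le> card J" "Y \<subseteq> geom_simplex \<sigma>"
    and lip: "\<And>y z. y \<in> Y \<Longrightarrow> z \<in> Y \<Longrightarrow> l1 J (g y) (g z) \<le> C * l1 \<sigma> y z"
  shows "small J (g ` Y)"
proof -
  obtain v where v: "v \<in> \<sigma>" using assms(2) by blast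
  obtain D :: nat where D: "C \<le> real D" using real_arch_simple by blast
  \<comment> \<open>The factors are the loss from dropping a coordinate, the number of coordinates
    and the Lipschitz bound; the \<open>+ 1\<close> makes the diameter estimate strict.\<close>
  define m where "m = 2 * card \<sigma> * D + 1"
  have "\<exists>P. fine_cover J N P (g ` Y) \<and> card P \<le> (m + 1) ^ (card J - 1) * N ^ (card J - 1)"
    if N: "N \<ge> 1" for N :: nat
  proof -
    define cell where "cell y = restrict (\<lambda>i. nat \<lfloor>real (N * m) * y i\<rfloor>) (\<sigma> - {v})" for y
    define Z where "Z = PiE (\<sigma> - {v}) (\<lambda>_. {..N * m})"
    define P where "P = (\<lambda>u. g ` {y \<in> Y. cell y = u}) ` Z"
    have fin: "finite Z" unfolding Z_def using assms(1) by (intro finite_PiE) auto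
    have "m > 0" by (simp add: m_def)
    then have m: "real m > 0" "real (N * m) > 0" using N by simp_all
    have bnd: "0 \<le> y i \<and> y i \<le> 1" if "y \<in> Y" "i \<in> \<sigma>" for y i
    proof -
      have "y \<in> geom_simplex \<sigma>" using that assms(4) by auto
      then show ?thesis
        using member_le_sum[of i \<sigma> y] that(2) assms(1) by (auto simp: geom_simplex_def)
    qed
    have cellZ: "cell y \<in> Z" if "y \<in> Y" for y
    proof -
      have "nat \<lfloor>real (N * m) * y i\<rfloor> \<le> N * m" if "i \<in> \<sigma>" for i
      proof -
        have "real (N * m) * y i \<le> real (N * m) * 1"
          using bnd[OF \<open>y \<in> Y\<close> that] by (intro mult_left_mono) auto
        then have "\<lfloor>real (N * m) * y i\<rfloor> \<le> int (N * m)" by linarith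
        then show ?thesis by linarith
      qed
      then show ?thesis by (auto simp: cell_def Z_def)
    qed
    have "card P \<le> card Z" unfolding P_def by (rule card_image_le[OF fin])
    also have "card Z = (N * m + 1) ^ (card \<sigma> - 1)"
      using assms(1) v by (simp add: Z_def card_PiE)
    also have "\<dots> \<le> (N * m + 1) ^ (card J - 1)"
      using assms(3) by (intro power_increasing) auto
    also have "\<dots> \<le> (N * (m + 1)) ^ (card J - 1)"
      using N by (intro power_mono) auto
    also have "\<dots> = (m + 1) ^ (card J - 1) * N ^ (card J - 1)"
      by (subst power_mult_distrib) (rule mult.commute)
    finally have 1: "card P \<le> (m + 1) ^ (card J - 1) * N ^ (card J - 1)" .
    have 2: "g ` Y \<subseteq> \<Union>P" using cellZ by (auto simp: P_def)
    have 3: "real N * l1 J (g y) (g z) < 1" if yz: "y \<in> Y" "z \<in> Y" "cell y = cell z" for y z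
    proof -
      have c: "real (N * m) * \<bar>y i - z i\<bar> \<le> 1" if i: "i \<in> \<sigma> - {v}" for i
      proof -
        have "nat \<lfloor>real (N * m) * y i\<rfloor> = nat \<lfloor>real (N * m) * z i\<rfloor>"
          using fun_cong[OF yz(3), of i] i by (simp add: cell_def)
        moreover have "\<lfloor>real (N * m) * y i\<rfloor> \<ge> 0" "\<lfloor>real (N * m) * z i\<rfloor> \<ge> 0"
          using bnd[OF yz(1)] bnd[OF yz(2)] i by auto
        ultimately have "\<lfloor>real (N * m) * y i\<rfloor> = \<lfloor>real (N * m) * z i\<rfloor>" by linarith
        then have "\<bar>real (N * m) * y i - real (N * m) * z i\<bar> \<le> 1" by linarith
        moreover have "real (N * m) * y i - real (N * m) * z i = real (N * m) * (y i - z i)"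
          by (simp add: algebra_simps)
        ultimately show ?thesis using m(2) by (simp only: abs_mult abs_of_pos)
      qed
      have "real (N * m) * l1 (\<sigma> - {v}) y z = (\<Sum>i\<in>\<sigma> - {v}. real (N * m) * \<bar>y i - z i\<bar>)"
        by (simp add: l1_def sum_distrib_left)
      also have "\<dots> \<le> real (card (\<sigma> - {v})) * 1"
        using c by (rule sum_bounded_above)
      also have "\<dots> \<le> real (card \<sigma>)" using assms(1) by (simp add: card_mono)
      finally have s: "real (N * m) * l1 (\<sigma> - {v}) y z \<le> real (card \<sigma>)" .
      have "l1 J (g y) (g z) \<le> C * l1 \<sigma> y z" using lip yz by blast
      also have "\<dots> \<le> real D * (2 * l1 (\<sigma> - {v}) y z)"
        using D l1_simplex_le[OF assms(1) v] yz assms(4) by (intro mult_mono) auto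
      finally have "real (N * m) * l1 J (g y) (g z) \<le> real (N * m) * (real D * (2 * l1 (\<sigma> - {v}) y z))"
        using m by (intro mult_left_mono) auto
      also have "\<dots> = 2 * real D * (real (N * m) * l1 (\<sigma> - {v}) y z)" by simp
      also have "\<dots> \<le> 2 * real D * real (card \<sigma>)"
        using s by (intro mult_left_mono) auto
      also have "\<dots> < real m" by (simp add: m_def)
      finally have "real m * (real N * l1 J (g y) (g z)) < real m * 1" by (simp add: mult_ac)
      then show ?thesis using m(1) by (simp only: mult_less_cancel_left_pos)
    qed
    have "real N * l1 J x y < 1" if B: "B \<in> P" "x \<in> B" "y \<in> B" for B x y
      using B 3 by (auto simp: P_def)
    moreover have "finite P" using fin by (simp add: P_def)
    ultimately have "fine_cover J N P (g ` Y)" using 2 unfolding fine_cover_def by blast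
    with 1 show ?thesis by blast
  qed
  then show ?thesis unfolding small_def by blast
qed

text \<open>Pigeonhole: the grid points \<open>u / (m R)\<close> with \<open>u < m\<close> are \<open>m ^ card J\<close> many, too many for a
  cover with \<open>c (m R) ^ (card J - 1)\<close> members.\<close>

lemma small_avoids:
  assumes "finite J" "J \<noteq> {}" "small J S" "d > 0"
  obtains w where "\<And>j. j \<notin> J \<Longrightarrow> w j = 0" "\<And>j. j \<in> J \<Longrightarrow> \<bar>w j\<bar> \<le> d"
    "\<And>x. x \<in> S \<Longrightarrow> \<exists>j\<in>J. x j \<noteq> w j"
proof -
  obtain c where c: "\<And>N. N \<ge> 1 \<Longrightarrow> \<exists>P. fine_cover J N P S \<and> card P \<le> c * N ^ (card J - 1)"
    using assms(3) unfolding small_def by meson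
  obtain R :: nat where R: "1 / d \<le> real R" "R \<ge> 1"
    using real_arch_simple[of "max 1 (1 / d)"] by auto
  define q where "q = card J - 1"
  have q: "card J = Suc q" using assms(1,2) by (simp add: q_def card_gt_0_iff)
  \<comment> \<open>\<open>R\<close> controls the size of the vector: grid coordinates are at most
    \<open>m / N = 1 / R \<le> d\<close>. \<open>m\<close> is the least number above
    \<open>c * R ^ q\<close>, which gives more grid points, \<open>m ^ Suc q\<close>, than cover
    members, \<open>c * (m * R) ^ q\<close>.\<close>
  define m where "m = c * R ^ q + 1"
  define N where "N = m * R"
  have N1: "N \<ge> 1" using R(2) by (simp add: N_def m_def)
  obtain P where "fine_cover J N P S" "card P \<le> c * N ^ q"
    using c[OF N1] unfolding q_def by blast
  then have P: "finite P" "card P \<le> c * N ^ q" "S \<subseteq> \<Union>P"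
    "\<And>B x y. B \<in> P \<Longrightarrow> x \<in> B \<Longrightarrow> y \<in> B \<Longrightarrow> real N * l1 J x y < 1"
    unfolding fine_cover_def by simp_all
  define grid where "grid u = (\<lambda>j. if j \<in> J then real (u j) / real N else 0)" for u :: "'a \<Rightarrow> nat"
  define G where "G = PiE J (\<lambda>_. {..<m})"
  have cG: "card G = m ^ Suc q" using assms(1) q by (simp add: G_def card_PiE)
  have "\<exists>u\<in>G. \<forall>x\<in>S. \<exists>j\<in>J. x j \<noteq> grid u j"
  proof (rule ccontr)
    assume "\<not> ?thesis"
    then have "\<forall>u\<in>G. \<exists>x\<in>S. \<forall>j\<in>J. x j = grid u j" by simp
    then have "\<forall>u\<in>G. \<exists>B. B \<in> P \<and> (\<exists>x\<in>B. \<forall>j\<in>J. x j = grid u j)"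
      using P(3) by (meson UnionE subsetD)
    then obtain b where b: "\<And>u. u \<in> G \<Longrightarrow> b u \<in> P"
      "\<And>u. u \<in> G \<Longrightarrow> \<exists>x\<in>b u. \<forall>j\<in>J. x j = grid u j"
      by metis
    have "inj_on b G"
    proof (rule inj_onI, rule ccontr)
      fix u u' assume u: "u \<in> G" "u' \<in> G" "b u = b u'" "u \<noteq> u'"
      obtain x x' where x: "x \<in> b u" "\<forall>j\<in>J. x j = grid u j" "x' \<in> b u" "\<forall>j\<in>J. x' j = grid u' j"
        using b(2)[OF u(1)] b(2)[OF u(2)] u(3) by metis
      obtain j where j: "j \<in> J" "u j \<noteq> u' j"
        using u PiE_ext[of u J "\<lambda>_. {..<m}" u'] by (auto simp: G_def)
      have "real N * \<bar>x j - x' j\<bar> = \<bar>real N * x j - real N * x' j\<bar>"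
        by (simp add: abs_mult right_diff_distrib[symmetric])
      also have "\<dots> = \<bar>real (u j) - real (u' j)\<bar>"
        using x j N1 by (simp add: grid_def)
      also have "\<dots> \<ge> 1" using j(2) by linarith
      finally have "1 \<le> real N * \<bar>x j - x' j\<bar>" .
      also have "\<dots> \<le> real N * l1 J x x'"
        using l1_coord_le[OF assms(1) j(1)] by (intro mult_left_mono) auto
      finally show False using P(4)[OF b(1)[OF u(1)] x(1,3)] by simp
    qed
    then have "card G \<le> card P"
      using b(1) P(1) by (metis card_inj_on_le image_subsetI)
    then have "m ^ Suc q \<le> c * (m * R) ^ q" using cG P(2) N_def by simp
    then have "m ^ q * m \<le> m ^ q * (c * R ^ q)" by (simp add: power_mult_distrib mult_ac)
    then show False by (simp add: m_def)
  qed
  then obtain u where u: "u \<in> G" "\<forall>x\<in>S. \<exists>j\<in>J. x j \<noteq> grid u j" by blast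
  show thesis
  proof (rule that[of "grid u"])
    fix j assume j: "j \<in> J"
    then have "u j < m" using u(1) PiE_mem[of u J "\<lambda>_. {..<m}" j] by (simp add: G_def)
    then have "real (u j) \<le> real m" by simp
    then have "real (u j) / real N \<le> real m / real N" by (intro divide_right_mono) auto
    also have "\<dots> = 1 / real R"
    proof -
      have "m \<noteq> 0" by (simp add: m_def)
      then show ?thesis by (simp add: N_def)
    qed
    also have "\<dots> \<le> d" using R assms(4) by (simp add: field_simps)
    finally show "\<bar>grid u j\<bar> \<le> d" using j by (simp add: grid_def)
  qed (use u(2) in \<open>auto simp: grid_def\<close>)
qed

section \<open>Realizations of simplicial complexes\<close>

lemma simplex_top_eq: "simplex_top \<sigma> = top_of_set (geom_simplex \<sigma>)"
proof -
  have "{x. \<forall>i. i \<notin> \<sigma> \<longrightarrow> x i = 0} \<inter> geom_simplex \<sigma> = geom_simplex \<sigma>"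
    by (auto simp: geom_simplex_def)
  then show ?thesis
    by (simp add: simplex_top_def coord_space_eq subtopology_subtopology)
qed

lemma geom_simplex_subset_coord_space: "geom_simplex \<sigma> \<subseteq> topspace (coord_space \<sigma>)"
  by (auto simp: geom_simplex_def topspace_coord_space)

lemma compact_geom_simplex:
  assumes "finite \<sigma>"
  shows "compact (geom_simplex \<sigma>)"
proof -
  let ?S = "{t. (\<forall>v. 0 \<le> t v) \<and> (\<Sum>v\<in>\<sigma>. t v) = (1::real)}"
  have "closed ?S"
    by (intro closed_Collect_conj closed_Collect_all closed_Collect_le closed_Collect_eq
        continuous_intros) auto
  then have "compact ({x \<in> topspace (coord_space \<sigma>). l1 \<sigma> (\<lambda>_. 0) x \<le> 1} \<inter> ?S)"
    using compact_l1_cball[OF assms] by blast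
  moreover have "{x \<in> topspace (coord_space \<sigma>). l1 \<sigma> (\<lambda>_. 0) x \<le> 1} \<inter> ?S = geom_simplex \<sigma>"
    by (auto simp: geom_simplex_def topspace_coord_space l1_def)
  ultimately show ?thesis by simp
qed

lemma compact_imp_closed_fun:
  fixes S :: "('i \<Rightarrow> real) set"
  shows "compact S \<Longrightarrow> closed S"
proof -
  assume "compact S"
  moreover have "Hausdorff_space (powertop_real (UNIV::'i set))"
    by (simp add: Hausdorff_space_product_topology)
  then have "Hausdorff_space (euclidean :: ('i \<Rightarrow> real) topology)"
    by (simp add: euclidean_product_topology)
  ultimately show ?thesis
    using compactin_imp_closedin[of euclidean S] by simp
qed

text \<open>Simplices on finite vertex sets are compact, hence closed in the function space, so
  closedness relative to a simplex is plain closedness of the trace.\<close>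

lemma closedin_realization:
  assumes "\<And>\<sigma>. \<sigma> \<in> K \<Longrightarrow> finite \<sigma>"
  shows "closedin (realization K) F \<longleftrightarrow>
    F \<subseteq> (\<Union>\<sigma>\<in>K. geom_simplex \<sigma>) \<and> (\<forall>\<sigma>\<in>K. closed (F \<inter> geom_simplex \<sigma>))"
proof -
  have "openin (simplex_top \<sigma>) (((\<Union>\<sigma>\<in>K. geom_simplex \<sigma>) - F) \<inter> geom_simplex \<sigma>) \<longleftrightarrow>
      closed (F \<inter> geom_simplex \<sigma>)" if "\<sigma> \<in> K" for \<sigma>
  proof -
    have "((\<Union>\<sigma>\<in>K. geom_simplex \<sigma>) - F) \<inter> geom_simplex \<sigma> =
        topspace (top_of_set (geom_simplex \<sigma>)) - F \<inter> geom_simplex \<sigma>"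
      using that by auto
    moreover have "closed (geom_simplex \<sigma>)"
      using compact_geom_simplex assms[OF that] compact_imp_closed_fun by blast
    ultimately have "openin (simplex_top \<sigma>) (((\<Union>\<sigma>\<in>K. geom_simplex \<sigma>) - F) \<inter> geom_simplex \<sigma>) \<longleftrightarrow>
        closedin (top_of_set (geom_simplex \<sigma>)) (F \<inter> geom_simplex \<sigma>)"
      by (simp add: simplex_top_eq closedin_def)
    also have "\<dots> \<longleftrightarrow> closed (F \<inter> geom_simplex \<sigma>)"
      using \<open>closed (geom_simplex \<sigma>)\<close> by (simp add: closedin_closed_eq)
    finally show ?thesis .
  qed
  then show ?thesis
    by (auto simp: closedin_def topspace_realization openin_realization)
qed

lemma continuous_map_simplex_realization:
  assumes "\<sigma> \<in> K"
  shows "continuous_map (top_of_set (geom_simplex \<sigma>)) (realization K) id"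
  unfolding continuous_map_alt
proof (intro conjI allI impI)
  fix U assume "openin (realization K) U"
  then have "openin (top_of_set (geom_simplex \<sigma>)) (U \<inter> geom_simplex \<sigma>)"
    using assms by (simp add: openin_realization simplex_top_eq)
  then show "openin (top_of_set (geom_simplex \<sigma>)) (id -` U \<inter> topspace (top_of_set (geom_simplex \<sigma>)))"
    by simp
qed (use assms in \<open>auto simp: topspace_realization\<close>)

text \<open>The support is the vertex set of the carrier, the smallest face containing
  \<open>t\<close>. Membership in a closed simplex thus depends only on the support, which is how
  points are transferred between simplices.\<close>

lemma geom_simplex_support:
  assumes "t \<in> geom_simplex \<sigma>"
  shows "{v. t v \<noteq> 0} \<subseteq> \<sigma>" "{v. t v \<noteq> 0} \<noteq> {}"
    "finite \<sigma> \<Longrightarrow> {v. t v \<noteq> 0} \<subseteq> \<tau> \<Longrightarrow> finite \<tau> \<Longrightarrow> t \<in> geom_simplex \<tau>"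
proof -
  show sub: "{v. t v \<noteq> 0} \<subseteq> \<sigma>" using assms by (auto simp: geom_simplex_def)
  have one: "(\<Sum>v\<in>\<sigma>. t v) = 1" using assms by (simp add: geom_simplex_def)
  show "{v. t v \<noteq> 0} \<noteq> {}"
  proof
    assume "{v. t v \<noteq> 0} = {}"
    then have "(\<Sum>v\<in>\<sigma>. t v) = 0" by simp
    with one show False by simp
  qed
  assume "finite \<sigma>" "{v. t v \<noteq> 0} \<subseteq> \<tau>" "finite \<tau>"
  then have "(\<Sum>v\<in>\<tau>. t v) = (\<Sum>v\<in>{v. t v \<noteq> 0}. t v)" "(\<Sum>v\<in>\<sigma>. t v) = (\<Sum>v\<in>{v. t v \<noteq> 0}. t v)"
    using sub by (auto intro: sum.mono_neutral_right)
  then show "t \<in> geom_simplex \<tau>"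
    using one assms \<open>{v. t v \<noteq> 0} \<subseteq> \<tau>\<close> by (auto simp: geom_simplex_def)
qed

lemma simplicial_cx_skeleton:
  assumes "simplicial_cx K"
  shows "simplicial_cx (skeleton j K)"
proof -
  have K: "finite \<sigma>" "\<sigma> \<noteq> {}" "\<tau> \<subseteq> \<sigma> \<Longrightarrow> \<tau> \<noteq> {} \<Longrightarrow> \<tau> \<in> K" if "\<sigma> \<in> K" for \<sigma> \<tau>
    using assms that unfolding simplicial_cx_def by blast+
  have "\<tau> \<in> skeleton j K" if "\<sigma> \<in> skeleton j K" "\<tau> \<subseteq> \<sigma>" "\<tau> \<noteq> {}" for \<sigma> \<tau>
  proof -
    have "\<sigma> \<in> K" using that(1) by (simp add: skeleton_def)
    then have "\<tau> \<in> K" "finite \<sigma>" using that K by blast+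
    moreover have "card \<tau> \<le> card \<sigma>" using that(2) \<open>finite \<sigma>\<close> card_mono by blast
    ultimately show ?thesis using that(1) by (simp add: skeleton_def)
  qed
  moreover have "finite \<sigma> \<and> \<sigma> \<noteq> {}" if "\<sigma> \<in> skeleton j K" for \<sigma>
    using that K by (simp add: skeleton_def)
  ultimately show ?thesis unfolding simplicial_cx_def by blast
qed

text \<open>The carrier of a point of \<open>F\<close> belongs to \<open>K'\<close>, so the trace of
  \<open>F\<close> on a simplex \<open>\<sigma>\<close> is the union of its traces on the finitely
  many faces of \<open>\<sigma>\<close> in \<open>K'\<close>. The lemma is what lets the restriction
  of a closed map to a skeleton remain closed.\<close>

lemma closedin_subcomplex:
  assumes K: "simplicial_cx K" and K': "simplicial_cx K'" "K' \<subseteq> K"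
    and F: "closedin (realization K') F"
  shows "closedin (realization K) F"
proof -
  have fin: "finite \<sigma>" if "\<sigma> \<in> K" for \<sigma> using K that by (simp add: simplicial_cx_def)
  have F': "F \<subseteq> (\<Union>\<sigma>\<in>K'. geom_simplex \<sigma>)" "\<And>\<sigma>. \<sigma> \<in> K' \<Longrightarrow> closed (F \<inter> geom_simplex \<sigma>)"
    using F closedin_realization[of K' F] fin K'(2) by auto
  have "closed (F \<inter> geom_simplex \<sigma>)" if \<sigma>: "\<sigma> \<in> K" for \<sigma>
  proof -
    define G where "G = {\<tau> \<in> K'. \<tau> \<subseteq> \<sigma>}"
    have "finite G" unfolding G_def
      by (rule finite_subset[of _ "Pow \<sigma>"]) (use fin[OF \<sigma>] in auto)
    moreover have "F \<inter> geom_simplex \<sigma> = (\<Union>\<tau>\<in>G. F \<inter> geom_simplex \<tau>)"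
    proof (intro equalityI subsetI)
      fix t assume t: "t \<in> F \<inter> geom_simplex \<sigma>"
      then obtain \<tau> where \<tau>: "\<tau> \<in> K'" "t \<in> geom_simplex \<tau>" using F'(1) by blast
      let ?s = "{v. t v \<noteq> 0}"
      have s: "?s \<subseteq> \<tau>" "?s \<subseteq> \<sigma>" "?s \<noteq> {}"
        using geom_simplex_support(1,2)[of t] \<tau>(2) t by auto
      then have "?s \<in> K'" using K'(1) \<tau>(1) unfolding simplicial_cx_def by blast
      moreover have "t \<in> geom_simplex ?s"
        using geom_simplex_support(3)[OF \<tau>(2)] fin s(1) \<open>?s \<in> K'\<close> \<tau>(1) K'(2) by blast
      ultimately show "t \<in> (\<Union>\<tau>\<in>G. F \<inter> geom_simplex \<tau>)" using s(2) t by (auto simp: G_def)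
    next
      fix t assume "t \<in> (\<Union>\<tau>\<in>G. F \<inter> geom_simplex \<tau>)"
      then obtain \<tau> where \<tau>: "\<tau> \<in> K'" "\<tau> \<subseteq> \<sigma>" "t \<in> F" "t \<in> geom_simplex \<tau>" by (auto simp: G_def)
      have "finite \<tau>" using \<tau>(1) K'(2) fin by blast
      moreover have "{v. t v \<noteq> 0} \<subseteq> \<sigma>" using geom_simplex_support(1)[OF \<tau>(4)] \<tau>(2) by blast
      ultimately have "t \<in> geom_simplex \<sigma>"
        using geom_simplex_support(3)[OF \<tau>(4)] fin[OF \<sigma>] by blast
      then show "t \<in> F \<inter> geom_simplex \<sigma>" using \<tau>(3) by simp
    qed
    moreover have "\<forall>\<tau>\<in>G. closed (F \<inter> geom_simplex \<tau>)" using F'(2) by (simp add: G_def)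
    ultimately show ?thesis using closed_UN[of G "\<lambda>\<tau>. F \<inter> geom_simplex \<tau>"] by simp
  qed
  moreover have "F \<subseteq> (\<Union>\<sigma>\<in>K. geom_simplex \<sigma>)" using F'(1) K'(2) by blast
  ultimately show ?thesis using closedin_realization[of K F] fin by simp
qed

lemma continuous_map_subcomplex:
  assumes "K' \<subseteq> K"
  shows "continuous_map (realization K') (realization K) id"
  unfolding continuous_map_alt
proof (intro conjI allI impI)
  fix U assume U: "openin (realization K) U"
  have "id -` U \<inter> topspace (realization K') \<inter> geom_simplex \<sigma> = U \<inter> geom_simplex \<sigma>" if "\<sigma> \<in> K'" for \<sigma>
    using that by (auto simp: topspace_realization)
  then show "openin (realization K') (id -` U \<inter> topspace (realization K'))"
    using U assms unfolding openin_realization by (simp add: subset_iff topspace_realization)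
qed (use assms in \<open>auto simp: topspace_realization\<close>)

text \<open>One point per support gives a set all of whose subsets are closed; hence it is finite.\<close>

lemma compactin_realization_finite:
  assumes K: "simplicial_cx K" and Q: "compactin (realization K) Q"
  obtains G where "finite G" "G \<subseteq> K" "Q \<subseteq> (\<Union>\<sigma>\<in>G. geom_simplex \<sigma>)"
proof -
  have fin: "finite \<sigma>" if "\<sigma> \<in> K" for \<sigma> using K that unfolding simplicial_cx_def by blast
  define supp where "supp t = {v. t v \<noteq> (0::real)}" for t :: "'a \<Rightarrow> real"
  have QK: "Q \<subseteq> (\<Union>\<sigma>\<in>K. geom_simplex \<sigma>)"
    using compactin_subset_topspace[OF Q] by (simp add: topspace_realization)
  have supp: "supp t \<in> K" "t \<in> geom_simplex (supp t)" if t: "t \<in> Q" for t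
  proof -
    obtain \<sigma> where \<sigma>: "\<sigma> \<in> K" "t \<in> geom_simplex \<sigma>" using QK t by blast
    have s: "supp t \<subseteq> \<sigma>" "supp t \<noteq> {}" using geom_simplex_support(1,2)[OF \<sigma>(2)] by (simp_all add: supp_def)
    then show "supp t \<in> K" using K \<sigma>(1) unfolding simplicial_cx_def by blast
    show "t \<in> geom_simplex (supp t)"
      using geom_simplex_support(3)[OF \<sigma>(2) fin[OF \<sigma>(1)], of "supp t"] finite_subset[OF s(1) fin[OF \<sigma>(1)]]
      by (simp add: supp_def)
  qed
  have "\<exists>Z\<subseteq>Q. inj_on supp Z \<and> supp ` Q = supp ` Z"
    by (rule subset_image_inj[THEN iffD1]) (rule order_refl)
  then obtain Z where Z: "Z \<subseteq> Q" "inj_on supp Z" "supp ` Z = supp ` Q" by auto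
  have closed: "closedin (realization K) Y" if "Y \<subseteq> Z" for Y
  proof -
    have finY: "finite (Y \<inter> geom_simplex \<sigma>)" if "\<sigma> \<in> K" for \<sigma>
    proof (rule inj_on_finite[of supp _ "Pow \<sigma>"])
      show "inj_on supp (Y \<inter> geom_simplex \<sigma>)" 
        by (rule inj_on_subset[OF Z(2)]) (use \<open>Y \<subseteq> Z\<close> in blast)
      show "supp ` (Y \<inter> geom_simplex \<sigma>) \<subseteq> Pow \<sigma>"
      proof
        fix s assume "s \<in> supp ` (Y \<inter> geom_simplex \<sigma>)"
        then obtain t where "s = supp t" "t \<in> geom_simplex \<sigma>" by blast
        then show "s \<in> Pow \<sigma>" using geom_simplex_support(1)[of t \<sigma>] by (simp add: supp_def)
      qed
    qed (use fin that in simp)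
    have "closed (Y \<inter> geom_simplex \<sigma>)" if "\<sigma> \<in> K" for \<sigma>
      by (intro compact_imp_closed_fun finite_imp_compact finY that)
    moreover have "Y \<subseteq> (\<Union>\<sigma>\<in>K. geom_simplex \<sigma>)" using that Z(1) QK by blast
    ultimately show ?thesis using closedin_realization[of K Y] fin by simp
  qed
  have "finite Z"
  proof (rule ccontr)
    assume "infinite Z"
    with compactin_imp_Bolzano_Weierstrass[of "realization K" Q Z] Q Z(1)
    obtain z where z: "z \<in> realization K derived_set_of Z" by auto
    \<comment> \<open>Being closed, \<open>Z - {z}\<close> contains its limit points; but
      \<open>z\<close> is one of them, since a limit point of \<open>Z\<close> is still one after
      its own removal.\<close>
    have "closedin (realization K) (Z - {z})" by (rule closed) blast
    then have "realization K derived_set_of (Z - {z}) \<subseteq> Z - {z}"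
      by (simp add: closedin_contains_derived_set)
    moreover have "z \<in> realization K derived_set_of (Z - {z})"
      using z unfolding in_derived_set_of by blast
    ultimately show False by blast
  qed
  then have "finite (supp ` Q)" unfolding Z(3)[symmetric] by (rule finite_imageI)
  moreover have "supp ` Q \<subseteq> K" using supp by blast
  moreover have "Q \<subseteq> (\<Union>\<sigma>\<in>supp ` Q. geom_simplex \<sigma>)" using supp by blast
  ultimately show thesis by (rule that)
qed

section \<open>Lipschitz continuity in charts\<close>

lemma is_chart_facts:
  assumes "is_chart n M (U, \<phi>)"
  shows "openin M U" "openin (Euclidean_space n) (\<phi> ` U)" "inj_on \<phi> U"
    "\<phi> ` U \<subseteq> topspace (coord_space {..<n})"
    "continuous_map (subtopology M U) (coord_space {..<n}) \<phi>"
    "continuous_map (subtopology (coord_space {..<n}) (\<phi> ` U)) (subtopology M U) (inv_into U \<phi>)"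
proof -
  show U: "openin M U" and O: "openin (Euclidean_space n) (\<phi> ` U)"
    using assms by (simp_all add: is_chart_def)
  have hom: "homeomorphic_map (subtopology M U) (subtopology (coord_space {..<n}) (\<phi> ` U)) \<phi>"
    using assms by (simp add: is_chart_def Euclidean_space_eq_coord_space)
  have topU: "topspace (subtopology M U) = U"
    using openin_subset[OF U] by auto
  show inj: "inj_on \<phi> U"
    using homeomorphic_imp_injective_map[OF hom] topU by simp
  show sub: "\<phi> ` U \<subseteq> topspace (coord_space {..<n})"
    using openin_subset[OF O] by (simp add: Euclidean_space_eq_coord_space)
  show "continuous_map (subtopology M U) (coord_space {..<n}) \<phi>"
    using homeomorphic_imp_continuous_map[OF hom] continuous_map_into_fulltopology by blast
  obtain g where g: "homeomorphic_maps (subtopology M U) (subtopology (coord_space {..<n}) (\<phi> ` U)) \<phi> g"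
    using hom by (auto simp: homeomorphic_map_maps)
  have "continuous_map (subtopology (coord_space {..<n}) (\<phi> ` U)) (subtopology M U) g"
    using g by (simp add: homeomorphic_maps_def)
  moreover have "g y = inv_into U \<phi> y" if y: "y \<in> topspace (subtopology (coord_space {..<n}) (\<phi> ` U))" for y
  proof -
    obtain x where x: "x \<in> U" "y = \<phi> x" using y by auto
    then have "g y = x" using g topU unfolding homeomorphic_maps_def by blast
    then show ?thesis using x inj by simp
  qed
  ultimately show "continuous_map (subtopology (coord_space {..<n}) (\<phi> ` U)) (subtopology M U) (inv_into U \<phi>)"
    by (rule continuous_map_eq)
qed

text \<open>The regularity carried through the induction. It is local at \<open>x\<close>, so that
  different points may use different charts, and relative to the closed simplex, so that boundary
  points need no extension of \<open>f\<close>.\<close>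

definition chart_lipschitz ::
  "nat \<Rightarrow> 'a chart \<Rightarrow> 'v set \<Rightarrow> (('v \<Rightarrow> real) \<Rightarrow> 'a) \<Rightarrow> ('v \<Rightarrow> real) \<Rightarrow> bool" where
  "chart_lipschitz n c \<sigma> f x \<longleftrightarrow> (\<exists>W C. open W \<and> x \<in> W \<and> (\<forall>y\<in>W \<inter> geom_simplex \<sigma>. f y \<in> fst c) \<and>
     (\<forall>y\<in>W \<inter> geom_simplex \<sigma>. \<forall>z\<in>W \<inter> geom_simplex \<sigma>.
        l1 {..<n} (snd c (f y)) (snd c (f z)) \<le> C * l1 \<sigma> y z))"

lemma chart_lipschitzI:
  assumes "open W" "x \<in> W" "\<And>y. y \<in> W \<Longrightarrow> y \<in> geom_simplex \<sigma> \<Longrightarrow> f y \<in> U"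
    "\<And>y z. y \<in> W \<Longrightarrow> y \<in> geom_simplex \<sigma> \<Longrightarrow> z \<in> W \<Longrightarrow> z \<in> geom_simplex \<sigma> \<Longrightarrow>
       l1 {..<n} (\<phi> (f y)) (\<phi> (f z)) \<le> C * l1 \<sigma> y z"
  shows "chart_lipschitz n (U, \<phi>) \<sigma> f x"
  unfolding chart_lipschitz_def using assms by (intro exI[of _ W] exI[of _ C]) auto

lemma chart_lipschitzE:
  assumes "chart_lipschitz n (U, \<phi>) \<sigma> f x"
  obtains W C where "open W" "x \<in> W" "C \<ge> 0" "\<And>y. y \<in> W \<Longrightarrow> y \<in> geom_simplex \<sigma> \<Longrightarrow> f y \<in> U"
    "\<And>y z. y \<in> W \<Longrightarrow> y \<in> geom_simplex \<sigma> \<Longrightarrow> z \<in> W \<Longrightarrow> z \<in> geom_simplex \<sigma> \<Longrightarrow>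
       l1 {..<n} (\<phi> (f y)) (\<phi> (f z)) \<le> C * l1 \<sigma> y z"
proof -
  obtain W C where W: "open W" "x \<in> W" "\<forall>y\<in>W \<inter> geom_simplex \<sigma>. f y \<in> U"
    "\<forall>y\<in>W \<inter> geom_simplex \<sigma>. \<forall>z\<in>W \<inter> geom_simplex \<sigma>.
        l1 {..<n} (\<phi> (f y)) (\<phi> (f z)) \<le> C * l1 \<sigma> y z"
    using assms unfolding chart_lipschitz_def fst_conv snd_conv by blast
  have "l1 {..<n} (\<phi> (f y)) (\<phi> (f z)) \<le> \<bar>C\<bar> * l1 \<sigma> y z"
    if "y \<in> W" "y \<in> geom_simplex \<sigma>" "z \<in> W" "z \<in> geom_simplex \<sigma>" for y z
  proof -
    have "l1 {..<n} (\<phi> (f y)) (\<phi> (f z)) \<le> C * l1 \<sigma> y z" using W(4) that by blast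
    also have "\<dots> \<le> \<bar>C\<bar> * l1 \<sigma> y z" by (intro mult_right_mono) auto
    finally show ?thesis .
  qed
  then show thesis using that[of W "\<bar>C\<bar>"] W(1-3) by simp
qed

lemma chart_lipschitz_change:
  assumes c: "is_chart n M (U, \<phi>)" and comp: "compatible_charts n (U, \<phi>) (V, \<psi>)"
    and x: "x \<in> geom_simplex \<sigma>" "f x \<in> V" and lip: "chart_lipschitz n (U, \<phi>) \<sigma> f x"
  shows "chart_lipschitz n (V, \<psi>) \<sigma> f x"
proof -
  note U = is_chart_facts[OF c]
  obtain W C where W: "open W" "x \<in> W" "C \<ge> 0" "\<And>y. y \<in> W \<Longrightarrow> y \<in> geom_simplex \<sigma> \<Longrightarrow> f y \<in> U"
    "\<And>y z. y \<in> W \<Longrightarrow> y \<in> geom_simplex \<sigma> \<Longrightarrow> z \<in> W \<Longrightarrow> z \<in> geom_simplex \<sigma> \<Longrightarrow>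
       l1 {..<n} (\<phi> (f y)) (\<phi> (f z)) \<le> C * l1 \<sigma> y z"
    using chart_lipschitzE[OF lip] by blast
  define g where "g = (\<lambda>y. \<psi> (inv_into U \<phi> y))"
  have sm: "smooth_map_on {..<n} n (\<phi> ` (U \<inter> V)) g"
    using comp by (simp add: compatible_charts_def g_def)
  have "\<phi> (f x) \<in> \<phi> ` (U \<inter> V)" using W(4)[OF W(2) x(1)] x(2) by blast
  then obtain e D where e: "e > 0" "D \<ge> 0"
    "\<And>y. y \<in> topspace (coord_space {..<n}) \<Longrightarrow> l1 {..<n} (\<phi> (f x)) y < e \<Longrightarrow> y \<in> \<phi> ` (U \<inter> V)"
    "\<And>y z. \<lbrakk>y \<in> topspace (coord_space {..<n}); z \<in> topspace (coord_space {..<n});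
        l1 {..<n} (\<phi> (f x)) y < e; l1 {..<n} (\<phi> (f x)) z < e\<rbrakk> \<Longrightarrow> l1 {..<n} (g y) (g z) \<le> D * l1 {..<n} y z"
    using smooth_map_on_locally_lipschitz[OF finite_lessThan sm] by blast
  \<comment> \<open>On this ball the Lipschitz bound keeps \<open>\<phi> (f y)\<close> within
    \<open>e\<close> of \<open>\<phi> (f x)\<close>, hence in the domain of the transition map; this
    also yields \<open>f y \<in> V\<close>. The \<open>+ 1\<close> keeps the divisor positive when
    \<open>C = 0\<close>.\<close>
  define W' where "W' = W \<inter> {y. l1 \<sigma> x y < e / (C + 1)}"
  have near: "f y \<in> U" "\<phi> (f y) \<in> topspace (coord_space {..<n})" "l1 {..<n} (\<phi> (f x)) (\<phi> (f y)) < e"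
    "f y \<in> V" "g (\<phi> (f y)) = \<psi> (f y)"
    if y: "y \<in> W'" "y \<in> geom_simplex \<sigma>" for y
  proof -
    show yU: "f y \<in> U" using W(4) y by (simp add: W'_def)
    then show top: "\<phi> (f y) \<in> topspace (coord_space {..<n})" using U(4) by blast
    have "l1 {..<n} (\<phi> (f x)) (\<phi> (f y)) \<le> C * l1 \<sigma> x y"
      using W(5)[OF W(2) x(1)] y by (simp add: W'_def)
    also have "\<dots> \<le> (C + 1) * l1 \<sigma> x y" by (intro mult_right_mono) auto
    also have "\<dots> < e"
      using y(1) W(3) by (simp add: W'_def less_divide_eq mult.commute)
    finally show le: "l1 {..<n} (\<phi> (f x)) (\<phi> (f y)) < e" .
    obtain u where u: "u \<in> U" "u \<in> V" "\<phi> (f y) = \<phi> u" using e(3)[OF top le] by blast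
    then show "f y \<in> V" using U(3) yU by (metis inj_onD)
    show "g (\<phi> (f y)) = \<psi> (f y)" using U(3) yU by (simp add: g_def)
  qed
  show ?thesis
  proof (rule chart_lipschitzI[of W' _ _ _ _ _ _ "D * C"])
    show "open W'" unfolding W'_def using W(1) open_l1_ball by blast
    show "x \<in> W'" using W(2,3) e(1) by (simp add: W'_def)
    fix y assume y: "y \<in> W'" "y \<in> geom_simplex \<sigma>"
    show "f y \<in> V" by (rule near(4)[OF y])
    fix z assume z: "z \<in> W'" "z \<in> geom_simplex \<sigma>"
    have "l1 {..<n} (\<psi> (f y)) (\<psi> (f z)) \<le> D * l1 {..<n} (\<phi> (f y)) (\<phi> (f z))"
      using e(4)[OF near(2)[OF y] near(2)[OF z] near(3)[OF y] near(3)[OF z]]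
      by (simp add: near(5)[OF y] near(5)[OF z])
    also have "\<dots> \<le> D * (C * l1 \<sigma> y z)"
      using W(5) y z e(2) by (intro mult_left_mono) (auto simp: W'_def)
    finally show "l1 {..<n} (\<psi> (f y)) (\<psi> (f z)) \<le> D * C * l1 \<sigma> y z" by (simp add: mult.assoc)
  qed
qed

text \<open>Passing through a chart of \<open>\<A>\<close> avoids showing that members of the maximal atlas are mutually
  compatible.\<close>

lemma chart_lipschitz_smooth_charts:
  assumes M: "smooth_manifold n M \<A>" and c: "c \<in> smooth_charts n M \<A>" and d: "d \<in> smooth_charts n M \<A>"
    and x: "x \<in> geom_simplex \<sigma>" "f x \<in> fst d" and lip: "chart_lipschitz n c \<sigma> f x"
  shows "chart_lipschitz n d \<sigma> f x"
proof -
  obtain U \<phi> where c': "c = (U, \<phi>)" by (cases c)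
  obtain V \<psi> where d': "d = (V, \<psi>)" by (cases d)
  have dV: "is_chart n M (V, \<psi>)" "\<And>a. a \<in> \<A> \<Longrightarrow> compatible_charts n (V, \<psi>) a"
    and cU: "is_chart n M (U, \<phi>)" "\<And>a. a \<in> \<A> \<Longrightarrow> compatible_charts n (U, \<phi>) a"
    using c d unfolding c' d' smooth_charts_def by blast+
  have "f x \<in> topspace M"
    using x(2) openin_subset[OF is_chart_facts(1)[OF dV(1)]] unfolding d' by auto
  then obtain a where a: "a \<in> \<A>" "f x \<in> fst a"
    using M unfolding smooth_manifold_def by blast
  obtain A \<alpha> where A: "a = (A, \<alpha>)" by (cases a)
  have chA: "is_chart n M (A, \<alpha>)" using M a(1) unfolding A smooth_manifold_def by blast
  have AV: "compatible_charts n (A, \<alpha>) (V, \<psi>)"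
    using dV(2)[OF a(1)] unfolding A compatible_charts_def prod.case Int_commute[of A V] by blast
  have lipA: "chart_lipschitz n (A, \<alpha>) \<sigma> f x"
  proof (rule chart_lipschitz_change[OF cU(1) _ x(1)])
    show "compatible_charts n (U, \<phi>) (A, \<alpha>)" using cU(2)[OF a(1)] A by simp
  qed (use a(2) lip in \<open>simp_all add: A c'\<close>)
  show ?thesis
    using chart_lipschitz_change[OF chA AV x(1) _ lipA] x(2) by (simp add: d')
qed

lemma smooth_simplex_embedding_chart_lipschitz:
  assumes "smooth_simplex_embedding n M \<A> \<sigma> h" "finite \<sigma>" "x \<in> geom_simplex \<sigma>"
  obtains c where "c \<in> smooth_charts n M \<A>" "chart_lipschitz n c \<sigma> h x"
proof -
  obtain U \<phi> W g where *: "(U, \<phi>) \<in> smooth_charts n M \<A>" "x \<in> W" "smooth_map_on \<sigma> n W g"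
    "\<forall>y\<in>W \<inter> geom_simplex \<sigma>. h y \<in> U \<and> \<phi> (h y) = g y"
    using assms(1,3) unfolding smooth_simplex_embedding_def by blast
  obtain e C where e: "e > 0" "C \<ge> 0"
    "\<And>y. y \<in> topspace (coord_space \<sigma>) \<Longrightarrow> l1 \<sigma> x y < e \<Longrightarrow> y \<in> W"
    "\<And>y z. \<lbrakk>y \<in> topspace (coord_space \<sigma>); z \<in> topspace (coord_space \<sigma>); l1 \<sigma> x y < e; l1 \<sigma> x z < e\<rbrakk>
        \<Longrightarrow> l1 {..<n} (g y) (g z) \<le> C * l1 \<sigma> y z"
    using smooth_map_on_locally_lipschitz[OF assms(2) *(3,2)] by blast
  have in_W: "y \<in> W" "y \<in> topspace (coord_space \<sigma>)" if "l1 \<sigma> x y < e" "y \<in> geom_simplex \<sigma>" for y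
    using e(3) that geom_simplex_subset_coord_space by blast+
  have "chart_lipschitz n (U, \<phi>) \<sigma> h x"
  proof (rule chart_lipschitzI[of "{y. l1 \<sigma> x y < e}" _ _ _ _ _ _ C])
    fix y assume y: "y \<in> {y. l1 \<sigma> x y < e}" "y \<in> geom_simplex \<sigma>"
    then show "h y \<in> U" using in_W *(4) by blast
    fix z assume z: "z \<in> {y. l1 \<sigma> x y < e}" "z \<in> geom_simplex \<sigma>"
    have "\<phi> (h y) = g y" "\<phi> (h z) = g z" using y z in_W *(4) by blast+
    then show "l1 {..<n} (\<phi> (h y)) (\<phi> (h z)) \<le> C * l1 \<sigma> y z"
      using e(4)[of y z] y z in_W by simp
  qed (use e(1) open_l1_ball in auto)
  then show thesis using that *(1) by blast
qed

section \<open>Cut-off translations in a chart\<close>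

lemma openin_chart_ball:
  assumes "is_chart n M (U, \<phi>)"
  shows "openin M {y \<in> U. l1 {..<n} a (\<phi> y) < R}"
proof -
  note U = is_chart_facts[OF assms]
  let ?B = "{x \<in> topspace (coord_space {..<n}). l1 {..<n} a x < R}"
  let ?V = "{y \<in> topspace (subtopology M U). \<phi> y \<in> ?B}"
  have "openin (coord_space {..<n}) ?B"
    unfolding coord_space_eq openin_open
    using open_l1_ball by (intro exI[of _ "{x. l1 {..<n} a x < R}"]) auto
  then have "openin (subtopology M U) ?V"
    by (rule openin_continuous_map_preimage[OF U(5)])
  then have "openin M ?V" by (rule openin_trans_full[OF _ U(1)])
  moreover have "?V = {y \<in> U. l1 {..<n} a (\<phi> y) < R}"
    using U(4) openin_subset[OF U(1)] by auto
  ultimately show ?thesis by simp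
qed

text \<open>Four radii are in play: the ball of radius \<open>r\<close> is to be cleared, the
  translation by \<open>w\<close> is complete up to \<open>2 * r\<close>, it has faded out at
  \<open>3 * r\<close>, and the chart contains the ball of radius \<open>4 * r\<close>. The cutoff
  has slope \<open>1 / r\<close>, so the bound \<open>r / 2\<close> on \<open>w\<close> makes the
  displacement a contraction with factor \<open>1 / 2\<close>.\<close>

locale chart_push =
  fixes n :: nat and M :: "'a topology" and U :: "'a set" and \<phi> :: "'a \<Rightarrow> nat \<Rightarrow> real"
    and a w :: "nat \<Rightarrow> real" and r :: real
  assumes hausdorff: "Hausdorff_space M" and chart: "is_chart n M (U, \<phi>)" and r: "r > 0"
    and ball: "\<And>x. x \<in> topspace (coord_space {..<n}) \<Longrightarrow> l1 {..<n} a x < 4 * r \<Longrightarrow> x \<in> \<phi> ` U"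
    and w_support: "\<And>j. j \<ge> n \<Longrightarrow> w j = 0"
    and w_small: "(\<Sum>j<n. \<bar>w j\<bar>) \<le> r / 2"
begin

definition bump :: "(nat \<Rightarrow> real) \<Rightarrow> real" where
  "bump x = max 0 (min 1 (3 - l1 {..<n} a x / r))"

definition shift :: "(nat \<Rightarrow> real) \<Rightarrow> nat \<Rightarrow> real" where
  "shift x = (\<lambda>j. x j + bump x * w j)"

definition push :: "'a \<Rightarrow> 'a" where
  "push y = (if y \<in> U then inv_into U \<phi> (shift (\<phi> y)) else y)"

definition core :: "real \<Rightarrow> 'a set" where
  "core R = {y \<in> U. l1 {..<n} a (\<phi> y) \<le> R}"

lemmas chart_facts = is_chart_facts[OF chart]

section \<open>Estimates for the cut-off translation in coordinates\<close>

lemma bump_bounds: "0 \<le> bump x" "bump x \<le> 1"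
  by (auto simp: bump_def)

lemma bump_eq_1: "l1 {..<n} a x \<le> 2 * r \<Longrightarrow> bump x = 1"
  using r by (simp add: bump_def min_def max_def field_simps)

lemma shift_eq_self: "l1 {..<n} a x \<ge> 3 * r \<Longrightarrow> shift x = x"
  using r by (simp add: shift_def bump_def min_def max_def field_simps)

lemma bump_lipschitz: "\<bar>bump x - bump y\<bar> \<le> l1 {..<n} x y / r"
proof -
  have "\<bar>bump x - bump y\<bar> \<le> \<bar>l1 {..<n} a x / r - l1 {..<n} a y / r\<bar>"
    unfolding bump_def by linarith
  also have "\<dots> = \<bar>l1 {..<n} a x - l1 {..<n} a y\<bar> / r"
    using r by (simp add: abs_divide flip: diff_divide_distrib)
  also have "\<dots> \<le> l1 {..<n} x y / r"
    using l1_triangle[of "{..<n}" a x y] l1_triangle[of "{..<n}" a y x] l1_commute[of "{..<n}" x y] r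
    by (intro divide_right_mono) auto
  finally show ?thesis .
qed

lemma shift_dist: "l1 {..<n} x (shift x) \<le> (\<Sum>j<n. \<bar>w j\<bar>)"
  unfolding l1_def
proof (rule sum_mono)
  fix j
  have "\<bar>x j - shift x j\<bar> = bump x * \<bar>w j\<bar>"
    using bump_bounds(1)[of x] by (simp add: shift_def abs_mult)
  also have "\<dots> \<le> 1 * \<bar>w j\<bar>" using bump_bounds(2) by (intro mult_right_mono) auto
  finally show "\<bar>x j - shift x j\<bar> \<le> \<bar>w j\<bar>" by simp
qed

text \<open>The displacements at \<open>x\<close> and \<open>y\<close> differ by the change of the
  cutoff times \<open>w\<close>, and \<open>1 / r\<close> times \<open>r / 2\<close> is
  \<open>1 / 2\<close>: \<open>shift\<close> is the identity plus a contraction.\<close>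

lemma shift_difference:
  "l1 {..<n} (\<lambda>j. shift x j - shift y j) (\<lambda>j. x j - y j) \<le> l1 {..<n} x y / 2"
proof -
  have "l1 {..<n} (\<lambda>j. shift x j - shift y j) (\<lambda>j. x j - y j) = \<bar>bump x - bump y\<bar> * (\<Sum>j<n. \<bar>w j\<bar>)"
    unfolding l1_def sum_distrib_left
    by (rule sum.cong) (simp_all add: shift_def flip: abs_mult left_diff_distrib)
  also have "\<dots> \<le> (l1 {..<n} x y / r) * (r / 2)"
    using bump_lipschitz w_small r by (intro mult_mono) (auto intro: sum_nonneg)
  also have "\<dots> = l1 {..<n} x y / 2" using r by simp
  finally show ?thesis .
qed

text \<open>Both bounds are the triangle inequality for a perturbation by at most half the distance;
  the upper constant \<open>3 / 2\<close> is rounded up to 2. The lower bound is the source of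
  injectivity.\<close>

lemma shift_lipschitz: "l1 {..<n} (shift x) (shift y) \<le> 2 * l1 {..<n} x y"
  and shift_expansion: "l1 {..<n} x y \<le> 2 * l1 {..<n} (shift x) (shift y)"
proof -
  have eq: "l1 {..<n} u v = l1 {..<n} (\<lambda>j. u j - v j) (\<lambda>_. 0)" for u v by (simp add: l1_def)
  let ?D = "l1 {..<n} (\<lambda>j. shift x j - shift y j) (\<lambda>j. x j - y j)"
  have "l1 {..<n} (shift x) (shift y) \<le> ?D + l1 {..<n} x y"
    unfolding eq[of "shift x"] eq[of x] by (rule l1_triangle)
  moreover have "l1 {..<n} x y \<le> ?D + l1 {..<n} (shift x) (shift y)"
    unfolding eq[of "shift x"] eq[of x] l1_commute[of _ "\<lambda>j. shift x j - shift y j" "\<lambda>j. x j - y j"]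
    by (rule l1_triangle)
  ultimately show "l1 {..<n} (shift x) (shift y) \<le> 2 * l1 {..<n} x y"
    "l1 {..<n} x y \<le> 2 * l1 {..<n} (shift x) (shift y)"
    using shift_difference[of x y] l1_nonneg[of "{..<n}" x y] by linarith+
qed

lemma shift_in_coord_space:
  "x \<in> topspace (coord_space {..<n}) \<Longrightarrow> shift x \<in> topspace (coord_space {..<n})"
  using w_support by (simp add: topspace_coord_space shift_def)

lemma shift_in_chart:
  assumes "x \<in> \<phi> ` U"
  shows "shift x \<in> \<phi> ` U"
proof (cases "l1 {..<n} a x \<ge> 3 * r")
  case True
  then show ?thesis using shift_eq_self assms by simp
next
  case False
  have "l1 {..<n} a (shift x) < 4 * r"
    using False l1_triangle[of "{..<n}" a "shift x" x] shift_dist[of x] w_small r by linarith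
  moreover have "x \<in> topspace (coord_space {..<n})" using assms chart_facts(4) by (rule rev_subsetD)
  ultimately show ?thesis using ball shift_in_coord_space by simp
qed

lemma continuous_on_shift: "continuous_on S shift"
proof (rule continuous_on_coordinatewise_then_product)
  fix j
  show "continuous_on S (\<lambda>x. shift x j)"
    unfolding shift_def bump_def
    by (intro continuous_intros continuous_on_id continuous_on_product_then_coordinatewise[of S "\<lambda>x. x"])
      (use r in auto)
qed

section \<open>The translation as a self-map of the manifold\<close>

lemma push_in_chart:
  assumes "y \<in> U"
  shows "push y \<in> U" "\<phi> (push y) = shift (\<phi> y)"
proof -
  have *: "shift (\<phi> y) \<in> \<phi> ` U" by (rule shift_in_chart) (use assms in simp)
  have "push y = inv_into U \<phi> (shift (\<phi> y))" using assms by (simp add: push_def)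
  then show "push y \<in> U" "\<phi> (push y) = shift (\<phi> y)"
    using inv_into_into[OF *] f_inv_into_f[OF *] by simp_all
qed

lemma push_outside: "y \<notin> U \<Longrightarrow> push y = y"
  by (simp add: push_def)

lemma push_eq_self:
  assumes "y \<in> U \<Longrightarrow> l1 {..<n} a (\<phi> y) \<ge> 3 * r"
  shows "push y = y"
proof (cases "y \<in> U")
  case True
  then have "push y = inv_into U \<phi> (\<phi> y)" using shift_eq_self assms by (simp add: push_def)
  then show ?thesis using True chart_facts(3) by simp
qed (rule push_outside)

lemma push_in_U_iff: "push y \<in> U \<longleftrightarrow> y \<in> U"
  using push_in_chart(1) push_outside by metis

lemma U_subset: "U \<subseteq> topspace M"
  using chart_facts(1) by (rule openin_subset)

lemma push_in_topspace: "y \<in> topspace M \<Longrightarrow> push y \<in> topspace M"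
  using U_subset push_in_chart(1) push_outside by (cases "y \<in> U") auto

text \<open>\<open>push\<close> preserves both \<open>U\<close> and its complement, so two points
  with the same image are both outside, where \<open>push\<close> is the identity, or both in the
  chart, where \<open>shift\<close> shrinks distances at most by half.\<close>

lemma inj_push: "inj push"
proof (rule injI)
  fix y z assume eq: "push y = push z"
  show "y = z"
  proof (cases "y \<in> U")
    case True
    then have z: "z \<in> U" using eq push_in_U_iff by metis
    have top: "\<phi> y \<in> topspace (coord_space {..<n})" "\<phi> z \<in> topspace (coord_space {..<n})"
      using True z chart_facts(4) by blast+
    have "shift (\<phi> y) = shift (\<phi> z)" using eq push_in_chart(2) True z by metis
    then have "l1 {..<n} (\<phi> y) (\<phi> z) = 0"
      using shift_expansion[of "\<phi> y" "\<phi> z"] l1_nonneg[of "{..<n}" "\<phi> y" "\<phi> z"] by simp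
    then have "\<phi> y = \<phi> z" using l1_eq_0_imp_eq[OF finite_lessThan top] by simp
    then show ?thesis using chart_facts(3) True z by (simp add: inj_on_eq_iff)
  next
    case False
    then have "z \<notin> U" using eq push_in_U_iff by metis
    then show ?thesis using False eq push_outside by metis
  qed
qed

lemma compactin_core:
  assumes "R < 4 * r"
  shows "compactin M (core R)"
proof -
  let ?B = "{x \<in> topspace (coord_space {..<n}). l1 {..<n} a x \<le> R}"
  have B: "?B \<subseteq> \<phi> ` U" using ball assms by fastforce
  have "compactin (coord_space {..<n}) ?B"
    using compact_l1_cball[OF finite_lessThan[of n], of a R]
    by (simp add: coord_space_eq compactin_subtopology subset_iff)
  then have "compactin (subtopology (coord_space {..<n}) (\<phi> ` U)) ?B"
    using B by (simp add: compactin_subtopology)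
  moreover have "continuous_map (subtopology (coord_space {..<n}) (\<phi> ` U)) M (inv_into U \<phi>)"
    by (rule continuous_map_into_fulltopology[OF chart_facts(6)])
  ultimately have "compactin M (inv_into U \<phi> ` ?B)" by (rule image_compactin)
  moreover have "inv_into U \<phi> ` ?B = core R"
  proof (intro equalityI subsetI)
    fix y assume "y \<in> inv_into U \<phi> ` ?B"
    then obtain x where x: "x \<in> ?B" "y = inv_into U \<phi> x" by blast
    then have "x \<in> \<phi> ` U" using B by blast
    then have "y \<in> U" "\<phi> y = x" using x(2) inv_into_into f_inv_into_f by metis+
    then show "y \<in> core R" using x(1) by (simp add: core_def)
  next
    fix y assume "y \<in> core R"
    then have y: "y \<in> U" "l1 {..<n} a (\<phi> y) \<le> R" by (simp_all add: core_def)
    then have "\<phi> y \<in> ?B" using chart_facts(4) by auto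
    then have "inv_into U \<phi> (\<phi> y) \<in> inv_into U \<phi> ` ?B" by (rule imageI)
    moreover have "inv_into U \<phi> (\<phi> y) = y" using y(1) chart_facts(3) by simp
    ultimately show "y \<in> inv_into U \<phi> ` ?B" by (simp only:)
  qed
  ultimately show ?thesis by simp
qed

lemma closedin_core: "R < 4 * r \<Longrightarrow> closedin M (core R)"
  using compactin_core hausdorff compactin_imp_closedin by blast

lemma push_eq_self_outside_core: "y \<notin> core (3 * r) \<Longrightarrow> push y = y"
  by (rule push_eq_self) (simp add: core_def)

lemma compact_chart_image:
  assumes "closedin M F" "R < 4 * r"
  shows "compact (\<phi> ` (F \<inter> core R))"
proof -
  have "compactin M (F \<inter> core R)"
    using assms compactin_core closed_Int_compactin by blast
  then have "compactin (subtopology M U) (F \<inter> core R)"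
    by (auto simp: compactin_subtopology core_def)
  then have "compactin (coord_space {..<n}) (\<phi> ` (F \<inter> core R))"
    using chart_facts(5) by (rule image_compactin)
  then show ?thesis by (simp add: coord_space_eq compactin_subtopology)
qed

text \<open>Glued from two open sets: on \<open>U\<close> the map is \<open>shift\<close> in
  coordinates, and off \<open>core (3 * r)\<close> it is the identity. The second set is open
  because a compact subset of a Hausdorff space is closed.\<close>

lemma continuous_map_push: "continuous_map M M push"
proof -
  have c1: "continuous_map (subtopology M U) (subtopology (coord_space {..<n}) (\<phi> ` U)) \<phi>"
    by (rule continuous_map_into_subtopology[OF chart_facts(5)]) auto
  have "{x. \<forall>i. i \<notin> {..<n} \<longrightarrow> x i = 0} \<inter> \<phi> ` U = \<phi> ` U"
    using chart_facts(4) unfolding topspace_coord_space by blast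
  then have top: "subtopology (coord_space {..<n}) (\<phi> ` U) = top_of_set (\<phi> ` U)"
    by (simp add: coord_space_eq subtopology_subtopology)
  have c2: "continuous_map (subtopology (coord_space {..<n}) (\<phi> ` U))
      (subtopology (coord_space {..<n}) (\<phi> ` U)) shift"
    unfolding top continuous_map_subtopology_eu using continuous_on_shift shift_in_chart by blast
  have c3: "continuous_map (subtopology (coord_space {..<n}) (\<phi> ` U)) M (inv_into U \<phi>)"
    by (rule continuous_map_into_fulltopology[OF chart_facts(6)])
  have "continuous_map (subtopology M U) M (inv_into U \<phi> \<circ> (shift \<circ> \<phi>))"
    by (rule continuous_map_compose[OF continuous_map_compose[OF c1 c2] c3])
  then have cU: "continuous_map (subtopology M U) M push"
    by (rule continuous_map_eq) (simp add: push_def)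
  show ?thesis
    unfolding continuous_map_alt
  proof (intro conjI allI impI)
    show "push \<in> topspace M \<rightarrow> topspace M" using push_in_topspace by blast
    fix V assume V: "openin M V"
    have "openin (subtopology M U) {y \<in> topspace (subtopology M U). push y \<in> V}"
      using cU V by (rule openin_continuous_map_preimage)
    then have "openin M {y \<in> topspace (subtopology M U). push y \<in> V}"
      by (rule openin_trans_full[OF _ chart_facts(1)])
    moreover have "openin M (V - core (3 * r))"
      using V closedin_core r by (intro openin_diff) auto
    ultimately have "openin M ({y \<in> topspace (subtopology M U). push y \<in> V} \<union> (V - core (3 * r)))"
      by (rule openin_Un)
    moreover have "{y \<in> topspace (subtopology M U). push y \<in> V} \<union> (V - core (3 * r)) =
        push -` V \<inter> topspace M"
    proof (intro equalityI subsetI)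
      fix y assume "y \<in> {y \<in> topspace (subtopology M U). push y \<in> V} \<union> (V - core (3 * r))"
      then show "y \<in> push -` V \<inter> topspace M"
        using push_eq_self_outside_core[of y] openin_subset[OF V] by auto
    next
      fix y assume y: "y \<in> push -` V \<inter> topspace M"
      show "y \<in> {y \<in> topspace (subtopology M U). push y \<in> V} \<union> (V - core (3 * r))"
        using y push_outside[of y] by (cases "y \<in> U") (auto simp: core_def)
    qed
    ultimately show "openin M (push -` V \<inter> topspace M)" by simp
  qed
qed

text \<open>The image of a closed set splits into the image of its compact part in
  \<open>core (3 * r)\<close> and the part off the open ball of radius \<open>3 * r\<close>, which
  stays fixed.\<close>

lemma closed_map_push: "closed_map M M push"
  unfolding closed_map_def
proof (intro allI impI)
  fix F assume F: "closedin M F"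
  have Fsub: "F \<subseteq> topspace M" using F by (rule closedin_subset)
  have "compactin M (F \<inter> core (3 * r))"
    using F compactin_core r by (intro closed_Int_compactin) auto
  then have "compactin M (push ` (F \<inter> core (3 * r)))"
    using continuous_map_push by (rule image_compactin)
  then have 1: "closedin M (push ` (F \<inter> core (3 * r)))"
    using hausdorff compactin_imp_closedin by blast
  define O' where "O' = {y \<in> U. l1 {..<n} a (\<phi> y) < 3 * r}"
  have "openin M O'" unfolding O'_def using chart by (rule openin_chart_ball)
  then have 2: "closedin M (F - O')" using F by (intro closedin_diff)
  have "push ` F = push ` (F \<inter> core (3 * r)) \<union> (F - O')"
  proof -
    have "push y = y" if "y \<in> F - O'" for y
      by (rule push_eq_self) (use that in \<open>auto simp: O'_def\<close>)
    then have "push ` (F - O') = F - O'" by force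
    moreover have "F = (F \<inter> core (3 * r)) \<union> (F - O')" by (auto simp: O'_def core_def)
    ultimately show ?thesis by (metis image_Un)
  qed
  then show "closedin M (push ` F)" using 1 2 by (simp add: closedin_Un)
qed

lemma chart_lipschitz_push:
  assumes M: "smooth_manifold n M \<A>" and U: "(U, \<phi>) \<in> smooth_charts n M \<A>"
    and c: "c \<in> smooth_charts n M \<A>" and x: "x \<in> geom_simplex \<sigma>"
    and cont: "continuous_map (top_of_set (geom_simplex \<sigma>)) M f"
    and lip: "chart_lipschitz n c \<sigma> f x"
  shows "\<exists>d\<in>smooth_charts n M \<A>. chart_lipschitz n d \<sigma> (push \<circ> f) x"
proof (cases "f x \<in> U")
  case True
  then have "chart_lipschitz n (U, \<phi>) \<sigma> f x"
    using chart_lipschitz_smooth_charts[OF M c U x _ lip] by simp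
  from chart_lipschitzE[OF this] obtain W C where W: "open W" "x \<in> W" "C \<ge> 0" "\<And>y. y \<in> W \<Longrightarrow> y \<in> geom_simplex \<sigma> \<Longrightarrow> f y \<in> U"
    "\<And>y z. y \<in> W \<Longrightarrow> y \<in> geom_simplex \<sigma> \<Longrightarrow> z \<in> W \<Longrightarrow> z \<in> geom_simplex \<sigma> \<Longrightarrow>
       l1 {..<n} (\<phi> (f y)) (\<phi> (f z)) \<le> C * l1 \<sigma> y z"
    by blast
  have "chart_lipschitz n (U, \<phi>) \<sigma> (push \<circ> f) x"
  proof (rule chart_lipschitzI[OF W(1,2), of _ _ _ _ _ "2 * C"])
    fix y assume y: "y \<in> W" "y \<in> geom_simplex \<sigma>"
    show "(push \<circ> f) y \<in> U" using push_in_chart(1) W(4)[OF y] by simp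
    fix z assume z: "z \<in> W" "z \<in> geom_simplex \<sigma>"
    have "l1 {..<n} (\<phi> ((push \<circ> f) y)) (\<phi> ((push \<circ> f) z)) = l1 {..<n} (shift (\<phi> (f y))) (shift (\<phi> (f z)))"
      using push_in_chart(2) W(4)[OF y] W(4)[OF z] by simp
    also have "\<dots> \<le> 2 * l1 {..<n} (\<phi> (f y)) (\<phi> (f z))" by (rule shift_lipschitz)
    also have "\<dots> \<le> 2 * C * l1 \<sigma> y z" using W(5)[OF y z] by simp
    finally show "l1 {..<n} (\<phi> ((push \<circ> f) y)) (\<phi> ((push \<circ> f) z)) \<le> 2 * C * l1 \<sigma> y z" .
  qed
  then show ?thesis using U by blast
next
  case False
  obtain V \<psi> where c': "c = (V, \<psi>)" by (cases c)
  obtain W C where W: "open W" "x \<in> W" "C \<ge> 0" "\<And>y. y \<in> W \<Longrightarrow> y \<in> geom_simplex \<sigma> \<Longrightarrow> f y \<in> V"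
    "\<And>y z. y \<in> W \<Longrightarrow> y \<in> geom_simplex \<sigma> \<Longrightarrow> z \<in> W \<Longrightarrow> z \<in> geom_simplex \<sigma> \<Longrightarrow>
       l1 {..<n} (\<psi> (f y)) (\<psi> (f z)) \<le> C * l1 \<sigma> y z"
    using chart_lipschitzE[OF lip[unfolded c']] by blast
  \<comment> \<open>By continuity of \<open>f\<close>, a neighbourhood of \<open>x\<close> in the
    simplex is mapped off \<open>core (3 * r)\<close>, where \<open>push\<close> is the identity, so
    the old chart and constant still serve.\<close>
  have "openin M (topspace M - core (3 * r))" using closedin_core r by (intro openin_diff) auto
  with cont have "openin (top_of_set (geom_simplex \<sigma>))
      {y \<in> topspace (top_of_set (geom_simplex \<sigma>)). f y \<in> topspace M - core (3 * r)}"
    by (rule openin_continuous_map_preimage)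
  then obtain T where T: "open T"
    "{y \<in> geom_simplex \<sigma>. f y \<in> topspace M - core (3 * r)} = geom_simplex \<sigma> \<inter> T"
    unfolding openin_open by auto
  have "f x \<in> topspace M" using cont x unfolding continuous_map_def by auto
  then have xT: "x \<in> T" using T(2) False x by (auto simp: core_def)
  have id: "push (f y) = f y" if "y \<in> T" "y \<in> geom_simplex \<sigma>" for y
    using T(2) that by (intro push_eq_self_outside_core) blast
  have "chart_lipschitz n (V, \<psi>) \<sigma> (push \<circ> f) x"
  proof (rule chart_lipschitzI[of "W \<inter> T" _ _ _ _ _ _ C])
    show "open (W \<inter> T)" using W(1) T(1) by (rule open_Int)
    show "x \<in> W \<inter> T" using W(2) xT by simp
    fix y assume y: "y \<in> W \<inter> T" "y \<in> geom_simplex \<sigma>"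
    then show "(push \<circ> f) y \<in> V" using W(4) id by simp
    fix z assume z: "z \<in> W \<inter> T" "z \<in> geom_simplex \<sigma>"
    show "l1 {..<n} (\<psi> ((push \<circ> f) y)) (\<psi> ((push \<circ> f) z)) \<le> C * l1 \<sigma> y z"
      using W(5)[of y z] y z id by simp
  qed
  then show ?thesis using c c' by blast
qed

end

section \<open>Moving a complex off a submanifold\<close>

text \<open>The induction invariant. Closedness and injectivity are listed in place of being an
  embedding: a closed image and properness follow from them directly, and both pass to the
  composition with \<open>push\<close>.\<close>

definition lipschitz_embedding ::
  "nat \<Rightarrow> 'a topology \<Rightarrow> 'a chart set \<Rightarrow> 'v set set \<Rightarrow> (('v \<Rightarrow> real) \<Rightarrow> 'a) \<Rightarrow> bool" where
  "lipschitz_embedding n M \<A> K f \<longleftrightarrow>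
     continuous_map (realization K) M f \<and> inj_on f (topspace (realization K)) \<and>
     closed_map (realization K) M f \<and>
     (\<forall>\<sigma>\<in>K. \<forall>x\<in>geom_simplex \<sigma>. \<exists>c\<in>smooth_charts n M \<A>. chart_lipschitz n c \<sigma> f x)"

lemma lipschitz_embedding_subcomplex:
  assumes K: "simplicial_cx K" "simplicial_cx K'" "K' \<subseteq> K"
    and h: "homeomorphic_map (realization K) M h"
    and smooth: "\<And>\<sigma>. \<sigma> \<in> K \<Longrightarrow> smooth_simplex_embedding n M \<A> \<sigma> h"
  shows "lipschitz_embedding n M \<A> K' h"
proof -
  have cont: "continuous_map (realization K) M h" and closed: "closed_map (realization K) M h"
    and inj: "inj_on h (topspace (realization K))"
    using h homeomorphic_imp_continuous_map homeomorphic_imp_closed_map homeomorphic_imp_injective_map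
    by blast+
  have "continuous_map (realization K') M (h \<circ> id)"
    by (rule continuous_map_compose[OF continuous_map_subcomplex[OF K(3)] cont])
  then have 1: "continuous_map (realization K') M h" by simp
  have 2: "inj_on h (topspace (realization K'))"
    by (rule inj_on_subset[OF inj]) (use K(3) in \<open>auto simp: topspace_realization\<close>)
  have 3: "closed_map (realization K') M h"
    using closed closedin_subcomplex[OF K] unfolding closed_map_def by blast
  have "\<exists>c\<in>smooth_charts n M \<A>. chart_lipschitz n c \<sigma> h x"
    if \<sigma>: "\<sigma> \<in> K'" and x: "x \<in> geom_simplex \<sigma>" for \<sigma> x
  proof -
    have "\<sigma> \<in> K" using \<sigma> K(3) by blast
    moreover have "finite \<sigma>" using \<sigma> K(2) unfolding simplicial_cx_def by blast
    ultimately obtain c where "c \<in> smooth_charts n M \<A>" "chart_lipschitz n c \<sigma> h x"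
      using smooth_simplex_embedding_chart_lipschitz[OF smooth _ x] by blast
    then show ?thesis by blast
  qed
  then show ?thesis using 1 2 3 unfolding lipschitz_embedding_def by blast
qed

lemma continuous_map_on_simplex:
  assumes "lipschitz_embedding n M \<A> K f" "\<sigma> \<in> K"
  shows "continuous_map (top_of_set (geom_simplex \<sigma>)) M f"
proof -
  have "continuous_map (realization K) M f" using assms(1) by (simp add: lipschitz_embedding_def)
  then have "continuous_map (top_of_set (geom_simplex \<sigma>)) M (f \<circ> id)"
    by (rule continuous_map_compose[OF continuous_map_simplex_realization[OF assms(2)]])
  then show ?thesis by simp
qed

lemma (in chart_push) lipschitz_embedding_push:
  assumes M: "smooth_manifold n M \<A>" and U: "(U, \<phi>) \<in> smooth_charts n M \<A>"
    and f: "lipschitz_embedding n M \<A> K f"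
  shows "lipschitz_embedding n M \<A> K (push \<circ> f)"
proof -
  have f': "continuous_map (realization K) M f" "inj_on f (topspace (realization K))"
    "closed_map (realization K) M f"
    using f by (simp_all add: lipschitz_embedding_def)
  have 1: "continuous_map (realization K) M (push \<circ> f)"
    by (rule continuous_map_compose[OF f'(1) continuous_map_push])
  have 2: "inj_on (push \<circ> f) (topspace (realization K))"
    by (rule comp_inj_on[OF f'(2) inj_on_subset[OF inj_push subset_UNIV]])
  have 3: "closed_map (realization K) M (push \<circ> f)"
    by (rule closed_map_compose[OF f'(3) closed_map_push])
  have "\<exists>d\<in>smooth_charts n M \<A>. chart_lipschitz n d \<sigma> (push \<circ> f) x"
    if \<sigma>: "\<sigma> \<in> K" and x: "x \<in> geom_simplex \<sigma>" for \<sigma> x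
  proof -
    obtain c where "c \<in> smooth_charts n M \<A>" "chart_lipschitz n c \<sigma> f x"
      using f \<sigma> x unfolding lipschitz_embedding_def by blast
    then show ?thesis
      using chart_lipschitz_push[OF M U _ x continuous_map_on_simplex[OF f \<sigma>]] by blast
  qed
  then show ?thesis using 1 2 3 unfolding lipschitz_embedding_def by blast
qed

section \<open>General position in a chart\<close>

lemma small_compact_image:
  assumes "compact Y" "\<And>x. x \<in> Y \<Longrightarrow> \<exists>W. open W \<and> x \<in> W \<and> small J (g ` (W \<inter> Y))"
  shows "small J (g ` Y)"
proof -
  have "\<exists>W. \<forall>x\<in>Y. open (W x) \<and> x \<in> W x \<and> small J (g ` (W x \<inter> Y))"
    by (rule bchoice) (use assms(2) in blast)
  then obtain W where W: "\<And>x. x \<in> Y \<Longrightarrow> open (W x)" "\<And>x. x \<in> Y \<Longrightarrow> x \<in> W x"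
    "\<And>x. x \<in> Y \<Longrightarrow> small J (g ` (W x \<inter> Y))"
    by blast
  have "Y \<subseteq> (\<Union>x\<in>Y. W x)" using W(2) by blast
  from compactE_image[OF assms(1) W(1) this]
  obtain T where T: "T \<subseteq> Y" "finite T" "Y \<subseteq> (\<Union>x\<in>T. W x)" by blast
  have "small J (\<Union>x\<in>T. g ` (W x \<inter> Y))"
    using T(1) W(3) by (intro small_UN[OF T(2)]) blast
  moreover have "g ` Y \<subseteq> (\<Union>x\<in>T. g ` (W x \<inter> Y))" using T(3) by blast
  ultimately show ?thesis by (rule small_subset)
qed

text \<open>\<open>f\<close> is proper, so the preimage of \<open>Q\<close> is compact and lies in
  finitely many simplices; on each, compactness reduces to finitely many Lipschitz pieces. No
  projection appears explicitly, because \<open>l1 J\<close> ignores the coordinates outside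
  \<open>J\<close>.\<close>

lemma small_chart_image:
  assumes M: "smooth_manifold n M \<A>" and K: "simplicial_cx K"
    and J: "J \<subseteq> {..<n}" and card: "\<And>\<sigma>. \<sigma> \<in> K \<Longrightarrow> card \<sigma> \<le> card J"
    and f: "lipschitz_embedding n M \<A> K f"
    and U: "(U, \<phi>) \<in> smooth_charts n M \<A>" and Q: "compactin M Q" "Q \<subseteq> U"
  shows "small J (\<phi> ` (f ` topspace (realization K) \<inter> Q))"
proof -
  have finK: "finite \<sigma>" "\<sigma> \<noteq> {}" if "\<sigma> \<in> K" for \<sigma>
    using K that unfolding simplicial_cx_def by blast+
  have f': "continuous_map (realization K) M f" "inj_on f (topspace (realization K))"
    "closed_map (realization K) M f"
    using f by (simp_all add: lipschitz_embedding_def)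
  define Q' where "Q' = {x \<in> topspace (realization K). f x \<in> Q}"
  have "proper_map (realization K) M f"
    by (rule closed_injective_imp_proper_map[OF f'(3,2)])
  then have Q': "compactin (realization K) Q'"
    unfolding Q'_def using Q(1) by (rule compactin_proper_map_preimage)
  obtain G where G: "finite G" "G \<subseteq> K" "Q' \<subseteq> (\<Union>\<sigma>\<in>G. geom_simplex \<sigma>)"
    by (rule compactin_realization_finite[OF K Q'])
  have "Hausdorff_space M" using M by (simp add: smooth_manifold_def)
  then have "closedin M Q" using Q(1) by (rule compactin_imp_closedin)
  then have "closedin (realization K) Q'"
    unfolding Q'_def by (rule closedin_continuous_map_preimage[OF f'(1)])
  then have "\<forall>\<sigma>\<in>K. closed (Q' \<inter> geom_simplex \<sigma>)"
    using closedin_realization[OF finK(1), of K Q'] by simp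
  then have closed: "closed (Q' \<inter> geom_simplex \<sigma>)" if "\<sigma> \<in> K" for \<sigma>
    using that by (rule bspec)
  have "small J ((\<phi> \<circ> f) ` (Q' \<inter> geom_simplex \<sigma>))" if \<sigma>: "\<sigma> \<in> G" for \<sigma>
  proof (rule small_compact_image)
    have \<sigma>K: "\<sigma> \<in> K" using \<sigma> G(2) by blast
    have "compact (geom_simplex \<sigma> \<inter> (Q' \<inter> geom_simplex \<sigma>))"
      by (rule compact_Int_closed[OF compact_geom_simplex[OF finK(1)[OF \<sigma>K]] closed[OF \<sigma>K]])
    then show "compact (Q' \<inter> geom_simplex \<sigma>)" by (simp add: Int_left_commute)
    fix x assume x: "x \<in> Q' \<inter> geom_simplex \<sigma>"
    then have fx: "f x \<in> U" "x \<in> geom_simplex \<sigma>" using Q(2) by (auto simp: Q'_def)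
    obtain c where c: "c \<in> smooth_charts n M \<A>" "chart_lipschitz n c \<sigma> f x"
      using f \<sigma>K fx(2) unfolding lipschitz_embedding_def by blast
    have "chart_lipschitz n (U, \<phi>) \<sigma> f x"
      using chart_lipschitz_smooth_charts[OF M c(1) U fx(2) _ c(2)] fx(1) by simp
    from chart_lipschitzE[OF this] obtain W C where W: "open W" "x \<in> W" "C \<ge> 0"
      "\<And>y. y \<in> W \<Longrightarrow> y \<in> geom_simplex \<sigma> \<Longrightarrow> f y \<in> U"
      "\<And>y z. y \<in> W \<Longrightarrow> y \<in> geom_simplex \<sigma> \<Longrightarrow> z \<in> W \<Longrightarrow> z \<in> geom_simplex \<sigma> \<Longrightarrow>
         l1 {..<n} (\<phi> (f y)) (\<phi> (f z)) \<le> C * l1 \<sigma> y z"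
      by blast
    have "small J ((\<phi> \<circ> f) ` (W \<inter> (Q' \<inter> geom_simplex \<sigma>)))"
    proof (rule small_lipschitz_image[OF finK[OF \<sigma>K] card[OF \<sigma>K]])
      fix y z assume "y \<in> W \<inter> (Q' \<inter> geom_simplex \<sigma>)" "z \<in> W \<inter> (Q' \<inter> geom_simplex \<sigma>)"
      then have "l1 {..<n} (\<phi> (f y)) (\<phi> (f z)) \<le> C * l1 \<sigma> y z" using W(5) by simp
      then show "l1 J ((\<phi> \<circ> f) y) ((\<phi> \<circ> f) z) \<le> C * l1 \<sigma> y z"
        using l1_mono[OF finite_lessThan J, of "\<phi> (f y)" "\<phi> (f z)"] by simp
    qed blast
    with W(1,2) show "\<exists>W. open W \<and> x \<in> W \<and> small J ((\<phi> \<circ> f) ` (W \<inter> (Q' \<inter> geom_simplex \<sigma>)))" by blast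
  qed
  then have "small J (\<Union>\<sigma>\<in>G. (\<phi> \<circ> f) ` (Q' \<inter> geom_simplex \<sigma>))"
    by (rule small_UN[OF G(1)])
  moreover have "\<phi> ` (f ` topspace (realization K) \<inter> Q) \<subseteq> (\<Union>\<sigma>\<in>G. (\<phi> \<circ> f) ` (Q' \<inter> geom_simplex \<sigma>))"
  proof
    fix u assume "u \<in> \<phi> ` (f ` topspace (realization K) \<inter> Q)"
    then obtain x where x: "x \<in> Q'" "u = (\<phi> \<circ> f) x" unfolding Q'_def by auto
    then obtain \<sigma> where \<sigma>: "\<sigma> \<in> G" "x \<in> geom_simplex \<sigma>" using G(3) by blast
    have "u \<in> (\<phi> \<circ> f) ` (Q' \<inter> geom_simplex \<sigma>)" using x \<sigma>(2) by auto
    then show "u \<in> (\<Union>\<sigma>\<in>G. (\<phi> \<circ> f) ` (Q' \<inter> geom_simplex \<sigma>))" by (rule UN_I[OF \<sigma>(1)])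
  qed
  ultimately show ?thesis by (rule small_subset)
qed

text \<open>One step of the induction: \<open>P\<close> is the closed set already cleared, and the
  translation is taken small enough not to bring the image back to it.\<close>

lemma push_off_slice:
  fixes K :: "'v set set" and L P :: "'a set"
  assumes M: "smooth_manifold n M \<A>" and K: "simplicial_cx K"
    and pn: "p < n" and card: "\<And>\<sigma>. \<sigma> \<in> K \<Longrightarrow> card \<sigma> \<le> n - p"
    and f: "lipschitz_embedding n M \<A> K f"
    and U: "(U, \<phi>) \<in> smooth_charts n M \<A>"
    and slice: "\<phi> ` (U \<inter> L) = \<phi> ` U \<inter> topspace (Euclidean_space p)"
    and r: "r > 0"
    and ball: "\<And>x. x \<in> topspace (coord_space {..<n}) \<Longrightarrow> l1 {..<n} a x < 4 * r \<Longrightarrow> x \<in> \<phi> ` U"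
    and P: "closedin M P" "P \<inter> f ` topspace (realization K) = {}"
  obtains f' where "lipschitz_embedding n M \<A> K f'" "P \<inter> f' ` topspace (realization K) = {}"
    "{y \<in> U \<inter> L. l1 {..<n} a (\<phi> y) \<le> r} \<inter> f' ` topspace (realization K) = {}"
proof -
  let ?X = "topspace (realization K)"
  have haus: "Hausdorff_space M" using M by (simp add: smooth_manifold_def)
  have chart: "is_chart n M (U, \<phi>)" using U unfolding smooth_charts_def by blast
  \<comment> \<open>The compact sets \<open>core R\<close> do not involve the translation vector but
    are needed to choose it; the zero translation gives access to their properties.\<close>
  interpret zero: chart_push n M U \<phi> a "\<lambda>_. 0" r
    using haus chart r ball by unfold_locales simp_all
  have core: "zero.core R \<subseteq> U" for R by (auto simp: zero.core_def)
  have "closed_map (realization K) M f" using f by (simp add: lipschitz_embedding_def)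
  then have fX: "closedin M (f ` ?X)" unfolding closed_map_def by blast
  have R: "7 / 2 * r < 4 * r" "3 * r < 4 * r" using r by auto
  \<comment> \<open>Moved points start within \<open>3 * r\<close> and travel at most
    \<open>r / 2\<close>, so \<open>7 / 2 * r\<close> is as far as they can reach; \<open>P\<close>
    and the image need to be separated only there.\<close>
  obtain e where e: "e > 0"
    "\<And>x y. x \<in> \<phi> ` (f ` ?X \<inter> zero.core (7 / 2 * r)) \<Longrightarrow> y \<in> \<phi> ` (P \<inter> zero.core (7 / 2 * r)) \<Longrightarrow>
      e \<le> l1 {..<n} x y"
  proof (rule compact_disjoint_l1_separated[OF finite_lessThan[of n]
        zero.compact_chart_image[OF fX R(1)] zero.compact_chart_image[OF P(1) R(1)]])
    have "\<phi> ` (f ` ?X \<inter> zero.core (7 / 2 * r)) \<inter> \<phi> ` (P \<inter> zero.core (7 / 2 * r)) =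
        \<phi> ` ((f ` ?X \<inter> zero.core (7 / 2 * r)) \<inter> (P \<inter> zero.core (7 / 2 * r)))"
      using core by (intro inj_on_image_Int[OF zero.chart_facts(3), symmetric]) blast+
    then show "\<phi> ` (f ` ?X \<inter> zero.core (7 / 2 * r)) \<inter> \<phi> ` (P \<inter> zero.core (7 / 2 * r)) = {}"
      using P(2) by blast
  qed (use core zero.chart_facts(4) in blast)+
  \<comment> \<open>Division by \<open>n\<close> turns the bound on each coordinate into one on
    their sum; \<open>r / 2\<close> is demanded by the cutoff, and \<open>e / 2\<close> is strictly
    below the separation \<open>e\<close>.\<close>
  define d where "d = min (r / 2) (e / 2) / real n"
  have n: "real n > 0" using pn by simp
  have d: "d > 0" using r e(1) n by (simp add: d_def)
  have sm: "small {p..<n} (\<phi> ` (f ` ?X \<inter> zero.core (3 * r)))"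
  proof (rule small_chart_image[OF M K _ _ f U zero.compactin_core[OF R(2)] core])
    show "{p..<n} \<subseteq> {..<n}" by auto
    show "card \<sigma> \<le> card {p..<n}" if "\<sigma> \<in> K" for \<sigma> using card[OF that] by simp
  qed
  have "{p..<n} \<noteq> {}" using pn by simp
  from small_avoids[OF finite_atLeastLessThan this sm d] obtain w where w: "\<And>j. j \<notin> {p..<n} \<Longrightarrow> w j = 0" "\<And>j. j \<in> {p..<n} \<Longrightarrow> \<bar>w j\<bar> \<le> d"
    "\<And>x. x \<in> \<phi> ` (f ` ?X \<inter> zero.core (3 * r)) \<Longrightarrow> \<exists>j\<in>{p..<n}. x j \<noteq> w j"
    by blast
  have "\<bar>- w j\<bar> \<le> d" for j using w(1)[of j] w(2)[of j] d by (cases "j \<in> {p..<n}") auto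
  then have "(\<Sum>j<n. \<bar>- w j\<bar>) \<le> real (card {..<n}) * d" by (intro sum_bounded_above)
  also have "\<dots> = min (r / 2) (e / 2)" using n by (simp add: d_def)
  finally have sum: "(\<Sum>j<n. \<bar>- w j\<bar>) \<le> min (r / 2) (e / 2)" .
  \<comment> \<open>The sign is negative because the image omits the value \<open>w\<close> in the
    last \<open>n - p\<close> coordinates: subtracting \<open>w\<close> leaves no point with all of
    them zero.\<close>
  interpret chart_push n M U \<phi> a "\<lambda>j. - w j" r
  proof unfold_locales
    show "- w j = 0" if "j \<ge> n" for j using w(1)[of j] that by simp
    show "(\<Sum>j<n. \<bar>- w j\<bar>) \<le> r / 2" using sum by simp
  qed (use haus chart r ball in simp_all)
  show thesis
  proof
    show "lipschitz_embedding n M \<A> K (push \<circ> f)" by (rule lipschitz_embedding_push[OF M U f])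
    show "P \<inter> (push \<circ> f) ` ?X = {}"
    proof (rule ccontr)
      assume "P \<inter> (push \<circ> f) ` ?X \<noteq> {}"
      then obtain x where x: "x \<in> ?X" "push (f x) \<in> P" by auto
      have fxP: "f x \<notin> P" using x(1) P(2) by blast
      have fx: "f x \<in> core (3 * r)"
      proof (rule ccontr)
        assume "f x \<notin> core (3 * r)"
        then have "push (f x) = f x" by (rule push_eq_self_outside_core)
        with x(2) fxP show False by simp
      qed
      then have fxU: "f x \<in> U" "l1 {..<n} a (\<phi> (f x)) \<le> 3 * r" by (simp_all add: core_def)
      note pu = push_in_chart[OF fxU(1)]
      have dist: "l1 {..<n} (\<phi> (f x)) (\<phi> (push (f x))) \<le> min (r / 2) (e / 2)"
        unfolding pu(2) using shift_dist[of "\<phi> (f x)"] sum by linarith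
      have "l1 {..<n} a (\<phi> (push (f x))) \<le> 7 / 2 * r"
        using l1_triangle[of "{..<n}" a "\<phi> (push (f x))" "\<phi> (f x)"] fxU(2) dist by linarith
      then have "push (f x) \<in> P \<inter> core (7 / 2 * r)" using pu(1) x(2) by (simp add: core_def)
      moreover have "f x \<in> f ` ?X \<inter> core (7 / 2 * r)" using fxU x(1) r by (simp add: core_def)
      ultimately have "e \<le> l1 {..<n} (\<phi> (f x)) (\<phi> (push (f x)))"
        by (intro e(2) imageI)
      then show False using dist e(1) by linarith
    qed
    show "{y \<in> U \<inter> L. l1 {..<n} a (\<phi> y) \<le> r} \<inter> (push \<circ> f) ` ?X = {}"
    proof (rule ccontr)
      assume "{y \<in> U \<inter> L. l1 {..<n} a (\<phi> y) \<le> r} \<inter> (push \<circ> f) ` ?X \<noteq> {}"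
      then obtain x where x: "x \<in> ?X" "push (f x) \<in> U" "push (f x) \<in> L"
        "l1 {..<n} a (\<phi> (push (f x))) \<le> r" by auto
      have fxU: "f x \<in> U" using x(2) push_in_U_iff by simp
      have eq: "\<phi> (push (f x)) = shift (\<phi> (f x))" by (rule push_in_chart(2)[OF fxU])
      \<comment> \<open>A point that ends within \<open>r\<close> started within
        \<open>3 / 2 * r\<close>, where the cutoff is 1, so it underwent the full
        translation.\<close>
      have le: "l1 {..<n} a (\<phi> (f x)) \<le> 2 * r"
        using l1_triangle[of "{..<n}" a "\<phi> (f x)" "shift (\<phi> (f x))"] shift_dist[of "\<phi> (f x)"]
          l1_commute[of "{..<n}" "\<phi> (f x)" "shift (\<phi> (f x))"] sum x(4) r unfolding eq by linarith
      then have "f x \<in> f ` ?X \<inter> zero.core (3 * r)" using x(1) fxU r by (simp add: core_def)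
      then obtain j where j: "j \<in> {p..<n}" "\<phi> (f x) j \<noteq> w j" using w(3) by blast
      have "\<phi> (push (f x)) \<in> topspace (Euclidean_space p)" using slice x(2,3) by blast
      then have "\<phi> (push (f x)) j = 0" using j(1) by (simp add: topspace_Euclidean_space)
      then have "\<phi> (f x) j = w j" unfolding eq shift_def using bump_eq_1[OF le] by simp
      with j(2) show False by simp
    qed
  qed
qed

lemma push_off_submanifold:
  fixes K :: "'v set set"
  assumes M: "smooth_manifold n M \<A>" and L: "smooth_submanifold n M \<A> p L" "compactin M L"
    and K: "simplicial_cx K" and pn: "p < n" and card: "\<And>\<sigma>. \<sigma> \<in> K \<Longrightarrow> card \<sigma> \<le> n - p"
    and f: "lipschitz_embedding n M \<A> K f"
  obtains f' where "lipschitz_embedding n M \<A> K f'" "L \<inter> f' ` topspace (realization K) = {}"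
proof -
  let ?X = "topspace (realization K)"
  have haus: "Hausdorff_space M" using M by (simp add: smooth_manifold_def)
  define slice_ball where "slice_ball y U \<phi> r \<longleftrightarrow> (U, \<phi>) \<in> smooth_charts n M \<A> \<and> y \<in> U \<and>
      \<phi> ` (U \<inter> L) = \<phi> ` U \<inter> topspace (Euclidean_space p) \<and> r > 0 \<and>
      (\<forall>x\<in>topspace (coord_space {..<n}). l1 {..<n} (\<phi> y) x < 4 * r \<longrightarrow> x \<in> \<phi> ` U)" for y U \<phi> r
  have "\<exists>U \<phi> r. slice_ball y U \<phi> r" if y: "y \<in> L" for y
  proof -
    obtain U \<phi> where U: "(U, \<phi>) \<in> smooth_charts n M \<A>" "y \<in> U"
      "\<phi> ` (U \<inter> L) = \<phi> ` U \<inter> topspace (Euclidean_space p)"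
      using L(1) y unfolding smooth_submanifold_def by blast
    have "is_chart n M (U, \<phi>)" using U(1) by (simp add: smooth_charts_def)
    then have op: "openin (coord_space {..<n}) (\<phi> ` U)"
      using is_chart_facts(2) unfolding Euclidean_space_eq_coord_space by blast
    have "\<phi> y \<in> \<phi> ` U" using U(2) by simp
    from openin_coord_space_ball[OF op finite_lessThan this] obtain e where e: "e > 0"
      "\<And>x. x \<in> topspace (coord_space {..<n}) \<Longrightarrow> l1 {..<n} (\<phi> y) x < e \<Longrightarrow> x \<in> \<phi> ` U"
      by blast
    have "slice_ball y U \<phi> (e / 4)"
      unfolding slice_ball_def using U e by simp
    then show ?thesis by blast
  qed
  then have "\<exists>U \<phi> r. \<forall>y\<in>L. slice_ball y (U y) (\<phi> y) (r y)" by metis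
  then obtain U \<phi> r where "\<forall>y\<in>L. slice_ball y (U y) (\<phi> y) (r y)" by blast
  then have chart: "\<And>y. y \<in> L \<Longrightarrow> (U y, \<phi> y) \<in> smooth_charts n M \<A>"
    and yU: "\<And>y. y \<in> L \<Longrightarrow> y \<in> U y"
    and slice: "\<And>y. y \<in> L \<Longrightarrow> \<phi> y ` (U y \<inter> L) = \<phi> y ` U y \<inter> topspace (Euclidean_space p)"
    and r: "\<And>y. y \<in> L \<Longrightarrow> r y > 0"
    and ball: "\<And>y x. y \<in> L \<Longrightarrow> x \<in> topspace (coord_space {..<n}) \<Longrightarrow>
      l1 {..<n} (\<phi> y y) x < 4 * r y \<Longrightarrow> x \<in> \<phi> y ` U y"
    unfolding slice_ball_def by blast+
  have is_chart: "is_chart n M (U y, \<phi> y)" if "y \<in> L" for y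
    using chart[OF that] by (simp add: smooth_charts_def)
  define V where "V y = {z \<in> U y. l1 {..<n} (\<phi> y y) (\<phi> y z) < r y}" for y
  \<comment> \<open>The open balls \<open>V y\<close> serve to extract a finite subcover of
    \<open>L\<close>. The sets cleared are the closed pieces \<open>D y\<close>, since the cleared
    set must be closed when the next move is made.\<close>
  define D where "D y = {z \<in> U y \<inter> L. l1 {..<n} (\<phi> y y) (\<phi> y z) \<le> r y}" for y
  have closedD: "closedin M (D y)" if y: "y \<in> L" for y
  proof -
    interpret push: chart_push n M "U y" "\<phi> y" "\<phi> y y" "\<lambda>_. 0" "r y"
      using haus is_chart[OF y] r[OF y] ball[OF y] by unfold_locales simp_all
    have "closedin M (push.core (r y))" using r[OF y] by (intro push.closedin_core) simp
    moreover have "closedin M L" using haus L(2) by (rule compactin_imp_closedin)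
    ultimately have "closedin M (push.core (r y) \<inter> L)" by (rule closedin_Int)
    moreover have "push.core (r y) \<inter> L = D y" by (auto simp: push.core_def D_def)
    ultimately show ?thesis by simp
  qed
  have openV: "openin M T" if "T \<in> V ` L" for T
    using that openin_chart_ball[OF is_chart] unfolding V_def by blast
  have "L \<subseteq> \<Union>(V ` L)" using yU r by (auto simp: V_def)
  with L(2) openV obtain \<F> where "finite \<F>" "\<F> \<subseteq> V ` L" "L \<subseteq> \<Union>\<F>"
    unfolding compactin_def by metis
  then obtain T where T: "T \<subseteq> L" "finite T" "L \<subseteq> (\<Union>y\<in>T. V y)"
    using finite_subset_image[of \<F> V L] by blast
  have "\<exists>f'. lipschitz_embedding n M \<A> K f' \<and> (\<Union>y\<in>T. D y) \<inter> f' ` ?X = {}"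
    using T(2,1)
  proof (induction T rule: finite_induct)
    case empty
    then show ?case using f by auto
  next
    case (insert y T)
    have y: "y \<in> L" using insert.prems by simp
    obtain f1 where f1: "lipschitz_embedding n M \<A> K f1" "(\<Union>y\<in>T. D y) \<inter> f1 ` ?X = {}"
      using insert.IH insert.prems by blast
    have closed: "closedin M (\<Union>y\<in>T. D y)"
      by (rule closedin_Union) (use insert.hyps insert.prems closedD in auto)
    obtain f2 where f2: "lipschitz_embedding n M \<A> K f2" "(\<Union>y\<in>T. D y) \<inter> f2 ` ?X = {}"
      "{z \<in> U y \<inter> L. l1 {..<n} (\<phi> y y) (\<phi> y z) \<le> r y} \<inter> f2 ` ?X = {}"
      by (rule push_off_slice[OF M K pn card f1(1) chart[OF y] slice[OF y] r[OF y] ball[OF y] closed f1(2)])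
    then have "(\<Union>y\<in>insert y T. D y) \<inter> f2 ` ?X = {}"
      unfolding UN_insert Int_Un_distrib2 D_def by simp
    with f2(1) show ?case by blast
  qed
  then obtain f' where f': "lipschitz_embedding n M \<A> K f'" "(\<Union>y\<in>T. D y) \<inter> f' ` ?X = {}" by blast
  have "L \<subseteq> (\<Union>y\<in>T. D y)"
  proof
    fix z assume z: "z \<in> L"
    then obtain y where "y \<in> T" "z \<in> V y" using T(3) by blast
    then show "z \<in> (\<Union>y\<in>T. D y)" using z by (auto simp: V_def D_def)
  qed
  with f'(2) have "L \<inter> f' ` ?X = {}" by blast
  with f'(1) show thesis by (rule that)
qed

theorem theorem1p2:
  fixes n p m :: nat
    and M :: "'a topology" and \<A> :: "'a chart set" and L :: "'a set"
    and K :: "'v set set"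
  assumes "smooth_manifold n M \<A>"
    and "smooth_submanifold n M \<A> p L" and "compactin M L"
    and "embeddable_in_R (subtopology M (topspace M - L)) m"
    and "smooth_triangulation n M \<A> K"
  shows "embeddable_in_R (realization (skeleton (int n - int p - 1) K)) m"
proof -
  define K' where "K' = skeleton (int n - int p - 1) K"
  let ?X = "realization K'"
  obtain h where h: "homeomorphic_map (realization K) M h"
      "\<And>\<sigma>. \<sigma> \<in> K \<Longrightarrow> smooth_simplex_embedding n M \<A> \<sigma> h" and K: "simplicial_cx K"
    using assms(5) unfolding smooth_triangulation_def by blast
  have K': "simplicial_cx K'" unfolding K'_def by (rule simplicial_cx_skeleton[OF K])
  have "K' \<subseteq> K" by (auto simp: K'_def skeleton_def)
  then have hK': "lipschitz_embedding n M \<A> K' h"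
    by (rule lipschitz_embedding_subcomplex[OF K K' _ h])
  obtain f where f: "lipschitz_embedding n M \<A> K' f" "L \<inter> f ` topspace ?X = {}"
  proof (cases "p < n")
    case True
    have "card \<sigma> \<le> n - p" if "\<sigma> \<in> K'" for \<sigma>
    proof -
      have "int (card \<sigma>) - 1 \<le> int n - int p - 1" using that by (simp add: K'_def skeleton_def)
      then show ?thesis by linarith
    qed
    then show ?thesis
      using push_off_submanifold[OF assms(1-3) K' True _ hK'] that by blast
  next
    case False
    \<comment> \<open>For \<open>p \<ge> n\<close> the skeleton has negative dimension, while
      simplices are nonempty; \<open>h\<close> then serves unchanged.\<close>
    have "K' = {}"
    proof (rule ccontr)
      assume "K' \<noteq> {}"
      then obtain \<sigma> where \<sigma>: "\<sigma> \<in> K'" by blast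
      then have "card \<sigma> > 0" using K' unfolding simplicial_cx_def by (simp add: card_gt_0_iff)
      moreover have "int (card \<sigma>) - 1 \<le> int n - int p - 1" using \<sigma> by (simp add: K'_def skeleton_def)
      ultimately show False using False by linarith
    qed
    then have "topspace ?X = {}" by (simp add: topspace_realization)
    then show ?thesis using that[OF hK'] by simp
  qed
  have f': "continuous_map ?X M f" "inj_on f (topspace ?X)" "closed_map ?X M f"
    using f(1) by (simp_all add: lipschitz_embedding_def)
  have "embedding_map ?X M f"
    using f' by (intro injective_closed_imp_embedding_map)
  \<comment> \<open>Since the image misses \<open>L\<close>, the embedding may be restricted to the
    codomain \<open>M - L\<close>, where the given embedding \<open>g\<close> is defined.\<close>
  moreover have "f ` topspace ?X \<subseteq> topspace M - L"
    using continuous_map_image_subset_topspace[OF f'(1)] f(2) by blast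
  ultimately have "embedding_map ?X (subtopology M (topspace M - L)) f"
    by (simp add: embedding_map_in_subtopology)
  moreover obtain g where "embedding_map (subtopology M (topspace M - L)) (Euclidean_space m) g"
    using assms(4) unfolding embeddable_in_R_def by blast
  ultimately have "embedding_map ?X (Euclidean_space m) (g \<circ> f)"
    by (rule embedding_map_compose)
  then show ?thesis unfolding embeddable_in_R_def K'_def by blast
qed

end
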